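(* Let $n\ge1$, let $\pi=\pi_1\cdots\pi_n\in S_n$, and let $\tau$ be a decreasing $\mathbb N$-tree whose postorder reading is $P(\tau)=\pi$. There is a unique pair $(\mathscr H,\mathscr T)$, where $\mathscr H\in\mathcal H(\pi)$ and $\mathscr T$ is an $\mathscr H$-admissible tuple of decreasing $\mathbb N$-trees, such that $\tau=g(\mathscr H,\mathscr T)$.
   Context: Notation: $\mathbb N=\{0,1,2,\ldots\}$, $[m]=\{1,\ldots,m\}$; permutations in $S_n$ are written as words $\pi_1\cdots\pi_n$. A descent of $\pi$ is an index $i\in[n-1]$ with $\pi_i>\pi_{i+1}$. Trees. An $\mathbb N$-tree is a (nonempty, finite) rooted plane tree: a root together with a $j$-tuple (ordered left to right) of $\mathbb N$-trees for some $j\in\mathbb N$. A decreasing $\mathbb N$-tree on a finite set $X$ of positive integers is an $\mathbb N$-tree whose vertices are labeled bijectively by the elements of $X$ so that each nonroot vertex has a smaller label than its parent. The postorder of a tree $\tau$, denoted $P(\tau)$, is the word obtained by recursively reading the subtrees of the root in postorder from left to right and then reading the root. Valid hook configurations. The diagram of $\pi$ consists of the points $(i,\pi_i)$, $i\in[n]$. A hook $H$ is determined by indices $i<j$ with $\pi_i<\pi_j$: it is the union of the vertical segment from $(i,\pi_i)$ to $(i,\pi_j)$ and the horizontal segment from $(i,\pi_j)$ to $(j,\pi_j)$. Its southwest endpoint is ${}_eH=(i,\pi_i)$ and its northeast endpoint is $H^e=(j,\pi_j)$. A valid hook configuration of $\pi$ is an $m$-tuple $\mathscr H=(H_1,\ldots,H_m)$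 ($m\ge 0$) of hooks in the diagram of $\pi$ such that: (a) if ${}_eH_\ell=(i_\ell,\pi_{i_\ell})$ for each $\ell\in[m]$, then $i_1<i_2<\cdots<i_m$; (b) if $i$ is a descent of $\pi$, then $(i,\pi_i)={}_eH_\ell$ for some $\ell\in[m]$; (c) if $(j,\pi_j)=H_\ell^e$ for some $\ell\in[m]$, then there exist $\ell',\ell''\in[m]$ such that the $x$-coordinate of ${}_eH_{\ell'}$ is a descent of $\pi$, $(j-1,\pi_{j-1})={}_eH_{\ell''}$, and $H_{\ell'}^e=H_{\ell''}^e=(j,\pi_j)$; (d) if $\ell,\ell'\in[m]$, ${}_eH_\ell=(i,\pi_i)$, $H_\ell^e=(j,\pi_j)$, ${}_eH_{\ell'}=(i',\pi_{i'})$, $H_{\ell'}^e=(j',\pi_{j'})$, $\pi_j<\pi_{j'}$, and the real intervals $[i,j]$ and $[i',j']$ have more than one point in common, then $[i,j]\subseteq[i',j']$. The identity permutation has exactly one valid hook configuration, the empty one. Write $\mathcal H(\pi)$ for the set of valid hook configurations of $\pi$, $SW(\mathscr H)=\{{}_eH_1,\ldots,{}_eH_m\}$ and $NE(\mathscr H)=\{H_1^e,\ldots,H_m^e\}$. Coloring. Given $\mathscr H=(H_1,\ldots,H_m)\in\mathcal H(\pi)$, color the points of the diagram with colors $c_0,\ldots,c_m$. The hook $H_\ell$ has color $c_\ell$; if ${}_eH_\ell=(i,\pi_i)$ and $H_\ell^e=(j,\pi_j)$, its top part is the segment from $(i+1/2,\pi_j)$ to $(j,\pi_j)$. If $(k,\pi_k)\in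 NE(\mathscr H)$, give $(k,\pi_k)$ the color $c_r$ where $r$ is the largest index with $H_r^e=(k,\pi_k)$. Otherwise move directly upward from $(k,\pi_k)$ until first hitting the top part of a hook, and give $(k,\pi_k)$ the color of that hook; if several hooks are hit simultaneously, use the one whose southwest endpoint is farthest to the right; if no top part is hit, use $c_0$. Let $Q_t(\mathscr H)$ be the set of entries $\pi_\ell$ such that $(\ell,\pi_\ell)$ has color $c_t$. Admissible tuples. An $\mathscr H$-admissible tuple is $\mathscr T=(T_0,T_1,\ldots,T_m)$ where, for each $t\in\{0,\ldots,m\}$, $T_t$ is a decreasing $\mathbb N$-tree on $Q_t(\mathscr H)$ whose postorder lists the elements of $Q_t(\mathscr H)$ in increasing order. The map $g$. Given $(\mathscr H,\mathscr T)$, construct decreasing $\mathbb N$-trees $\tau_n,\tau_{n-1},\ldots,\tau_1$, where $\tau_i$ has vertex set $\{\pi_i,\ldots,\pi_n\}$, as follows. $\tau_n$ is the single vertex $\pi_n$. Given $\tau_{\ell+1}$, build $\tau_\ell$ by attaching $\pi_\ell$ as a leaf: Case 1: $(\ell,\pi_\ell)\in SW(\mathscr H)$. Then $(\ell,\pi_\ell)$ is the southwest endpoint of a unique hook $H_i$; with $H_i^e=(j,\pi_j)$, attach $\pi_\ell$ as the new first (leftmost) child of $\pi_j$. Case 2: $(\ell,\pi_\ell)\notin SW(\mathscr H)$. Let $c_r$ be the color of $(\ell+1,\pi_{\ell+1})$, let $u$ be the largest element of $[\ell]$ such that $(u,\pi_u)$ has color $c_r$, and let $\pi_v$ be the parent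 of $\pi_u$ in $T_r$; attach $\pi_\ell$ as the new first (leftmost) child of $\pi_v$. (Here $u$ and $v$ always exist and $\pi_v$ is a vertex of $\tau_{\ell+1}$.) Set $g(\mathscr H,\mathscr T)=\tau_1$. *)

theory Defs
  imports Complex_Main "HOL-Combinatorics.Permutations"
begin

datatype 'a ntree = Node (root: 'a) (children: "'a ntree list")

primrec subtrees :: "'a ntree \<Rightarrow> 'a ntree set" where
  "subtrees (Node a ts) = insert (Node a ts) (\<Union> (set (map subtrees ts)))"

primrec postorder :: "'a ntree \<Rightarrow> 'a list" where
  "postorder (Node a ts) = concat (map postorder ts) @ [a]"

definition child_of :: "'a ntree \<Rightarrow> 'a \<Rightarrow> 'a \<Rightarrow> bool" where
  "child_of t p c \<longleftrightarrow> (\<exists>s \<in> subtrees t. root s = p \<and> (\<exists>s' \<in> set (children s). root s' = c))"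

(* The word postorder t has one entry per vertex of t, so distinctness of this word
   says that different vertices carry different labels. *)
definition decreasing_ntree_on :: "nat set \<Rightarrow> nat ntree \<Rightarrow> bool" where
  "decreasing_ntree_on X t \<longleftrightarrow>
     finite X \<and> (\<forall>x\<in>X. 0 < x) \<and>
     distinct (postorder t) \<and> set (postorder t) = X \<and>
     (\<forall>s \<in> subtrees t. \<forall>s' \<in> set (children s). root s' < root s)"

definition parent :: "'a ntree \<Rightarrow> 'a \<Rightarrow> 'a" where
  "parent t c = (THE p. child_of t p c)"

primrec attach_first :: "'a \<Rightarrow> 'a \<Rightarrow> 'a ntree \<Rightarrow> 'a ntree" where
  "attach_first a b (Node c ts) =
     Node c ((if c = b then [Node a []] else []) @ map (attach_first a b) ts)"

(* A permutation in S_n is a function \<pi> with \<pi> permutes {1..n}; its word is the list below.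
   Words, hooks and colors are all indexed from 1. *)
definition word_of :: "nat \<Rightarrow> (nat \<Rightarrow> nat) \<Rightarrow> nat list" where
  "word_of n \<pi> = map \<pi> [1..<Suc n]"

definition descent :: "nat \<Rightarrow> (nat \<Rightarrow> nat) \<Rightarrow> nat \<Rightarrow> bool" where
  "descent n \<pi> i \<longleftrightarrow> i \<in> {1..<n} \<and> \<pi> i > \<pi> (i + 1)"

(* The pair (i, j) stands for the hook from (i, \<pi> i) up to height \<pi> j and right to (j, \<pi> j). *)
type_synonym hook = "nat \<times> nat"

definition is_hook :: "nat \<Rightarrow> (nat \<Rightarrow> nat) \<Rightarrow> hook \<Rightarrow> bool" where
  "is_hook n \<pi> H \<longleftrightarrow>
     fst H \<in> {1..n} \<and> snd H \<in> {1..n} \<and> fst H < snd H \<and> \<pi> (fst H) < \<pi> (snd H)"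

definition sw :: "(nat \<Rightarrow> nat) \<Rightarrow> hook \<Rightarrow> nat \<times> nat" where
  "sw \<pi> H = (fst H, \<pi> (fst H))"

definition ne :: "(nat \<Rightarrow> nat) \<Rightarrow> hook \<Rightarrow> nat \<times> nat" where
  "ne \<pi> H = (snd H, \<pi> (snd H))"

definition hook_at :: "hook list \<Rightarrow> nat \<Rightarrow> hook" where
  "hook_at Hs l = Hs ! (l - 1)"

definition SW :: "(nat \<Rightarrow> nat) \<Rightarrow> hook list \<Rightarrow> (nat \<times> nat) set" where
  "SW \<pi> Hs = sw \<pi> ` set Hs"

definition NE :: "(nat \<Rightarrow> nat) \<Rightarrow> hook list \<Rightarrow> (nat \<times> nat) set" where
  "NE \<pi> Hs = ne \<pi> ` set Hs"

definition real_interval :: "hook \<Rightarrow> real set" where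
  "real_interval H = {real (fst H)..real (snd H)}"

definition valid_hook_configs :: "nat \<Rightarrow> (nat \<Rightarrow> nat) \<Rightarrow> hook list set" where
  "valid_hook_configs n \<pi> = {Hs.
     (\<forall>H \<in> set Hs. is_hook n \<pi> H) \<and>
     sorted_wrt (<) (map fst Hs) \<and>
     (\<forall>i. descent n \<pi> i \<longrightarrow> (\<exists>H \<in> set Hs. sw \<pi> H = (i, \<pi> i))) \<and>
     (\<forall>H \<in> set Hs. \<exists>H' \<in> set Hs. \<exists>H'' \<in> set Hs.
        descent n \<pi> (fst H') \<and>
        sw \<pi> H'' = (snd H - 1, \<pi> (snd H - 1)) \<and>
        ne \<pi> H' = ne \<pi> H \<and> ne \<pi> H'' = ne \<pi> H) \<and>
     (\<forall>H \<in> set Hs. \<forall>H' \<in> set Hs.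
        \<pi> (snd H) < \<pi> (snd H') \<and>
        (\<exists>x y. x \<noteq> y \<and> {x, y} \<subseteq> real_interval H \<inter> real_interval H') \<longrightarrow>
        real_interval H \<subseteq> real_interval H')}"

definition top_part :: "(nat \<Rightarrow> nat) \<Rightarrow> hook \<Rightarrow> (real \<times> real) set" where
  "top_part \<pi> H = {real (fst H) + 1/2..real (snd H)} \<times> {real (\<pi> (snd H))}"

definition heights_hit :: "(nat \<Rightarrow> nat) \<Rightarrow> hook list \<Rightarrow> nat \<Rightarrow> real set" where
  "heights_hit \<pi> Hs k =
     {y. y > real (\<pi> k) \<and> (\<exists>H \<in> set Hs. (real k, y) \<in> top_part \<pi> H)}"

(* The value t stands for the color c_t, where t is in {0..length Hs}. *)
definition color :: "(nat \<Rightarrow> nat) \<Rightarrow> hook list \<Rightarrow> nat \<Rightarrow> nat" where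
  "color \<pi> Hs k =
     (if (k, \<pi> k) \<in> NE \<pi> Hs
        then Max {r \<in> {1..length Hs}. ne \<pi> (hook_at Hs r) = (k, \<pi> k)}
      else if heights_hit \<pi> Hs k = {} then 0
      else (ARG_MAX (\<lambda>l. fst (hook_at Hs l)) l.
              l \<in> {1..length Hs} \<and>
              (real k, Min (heights_hit \<pi> Hs k)) \<in> top_part \<pi> (hook_at Hs l)))"

definition color_class :: "nat \<Rightarrow> (nat \<Rightarrow> nat) \<Rightarrow> hook list \<Rightarrow> nat \<Rightarrow> nat set" where
  "color_class n \<pi> Hs t = {\<pi> l | l. l \<in> {1..n} \<and> color \<pi> Hs l = t}"

definition admissible :: "nat \<Rightarrow> (nat \<Rightarrow> nat) \<Rightarrow> hook list \<Rightarrow> nat ntree list \<Rightarrow> bool" where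
  "admissible n \<pi> Hs Ts \<longleftrightarrow>
     length Ts = length Hs + 1 \<and>
     (\<forall>t \<in> {0..length Hs}.
        decreasing_ntree_on (color_class n \<pi> Hs t) (Ts ! t) \<and>
        sorted (postorder (Ts ! t)))"

definition attach_point ::
  "(nat \<Rightarrow> nat) \<Rightarrow> hook list \<Rightarrow> nat ntree list \<Rightarrow> nat \<Rightarrow> nat" where
  "attach_point \<pi> Hs Ts l =
     (if (l, \<pi> l) \<in> SW \<pi> Hs
        then \<pi> (snd (THE H. H \<in> set Hs \<and> sw \<pi> H = (l, \<pi> l)))
      else
        let r = color \<pi> Hs (l + 1);
            u = Max {u \<in> {1..l}. color \<pi> Hs u = r}
        in parent (Ts ! r) (\<pi> u))"

(* g_aux n \<pi> Hs Ts k is the tree \<tau>_{n-k}, with vertex set {\<pi> (n-k), ..., \<pi> n}. *)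
primrec g_aux ::
  "nat \<Rightarrow> (nat \<Rightarrow> nat) \<Rightarrow> hook list \<Rightarrow> nat ntree list \<Rightarrow> nat \<Rightarrow> nat ntree" where
  "g_aux n \<pi> Hs Ts 0 = Node (\<pi> n) []"
| "g_aux n \<pi> Hs Ts (Suc k) =
     attach_first (\<pi> (n - Suc k)) (attach_point \<pi> Hs Ts (n - Suc k)) (g_aux n \<pi> Hs Ts k)"

definition g_map :: "nat \<Rightarrow> (nat \<Rightarrow> nat) \<Rightarrow> hook list \<Rightarrow> nat ntree list \<Rightarrow> nat ntree" where
  "g_map n \<pi> Hs Ts = g_aux n \<pi> Hs Ts (n - 1)"

end

theory Submission
  imports Defs
begin

text \<open>A plane tree is determined by its postorder word and the parent of each vertex, and parent
  maps \<open>p\<close> on positions arise from trees exactly if they are noncrossing. Since \<open>g\<close> attaches the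
  vertices in reverse postorder, \<open>g(H, T) = \<tau>\<close> says just that every attachment point is the parent
  in \<open>\<tau>\<close>.

  The northeast endpoint of a hook is alone in its color class, so Case 2 never attaches a vertex to
  it. Hence the hooks must be the edges of \<open>\<tau>\<close> into those vertices that have a descent among their
  children. Consecutive elements \<open>u < u'\<close> of a color class correspond to the positions \<open>l = u' - 1\<close>
  that do not start a hook, and Case 2 at \<open>l\<close> forces the parent of \<open>u\<close> in its tree to be the
  parent of \<open>l\<close> in \<open>\<tau>\<close>. Conversely this prescription is a noncrossing parent map on each class.\<close>

section \<open>Plane trees and their parent maps\<close>

text \<open>The parent map of \<tau> lives on positions, whereas the trees of a tuple are
  constrained through their labels. The bridge is that labels increase with positions inside a color
  class: otherwise there would be a descent whose hook separates the two points. So an increasing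
  postorder fixes the word of each tree in the tuple, and only its parent map remains free. A
  northeast endpoint \<open>j\<close> is alone in its class because condition (c) supplies the hook
  \<open>(j - 1, j)\<close>, which covers nothing else. By (b) every descent starts a hook, which
  makes its parent in \<tau> such an endpoint; by (c) every northeast endpoint arises from a descent
  in this way. Existence hinges on one fact: if \<open>l\<close> starts no hook, its parent in
  \<tau> has the color of \<open>l + 1\<close>, so the parent that Case 2 prescribes does lie in the
  class.\<close>

lemma ntree_induct [case_names Leaf Cons]:
  assumes "\<And>a. P (Node a [])"
    and "\<And>a s ss. P s \<Longrightarrow> P (Node a ss) \<Longrightarrow> P (Node a (s # ss))"
  shows "P t"
proof (induction t)
  case (Node a ts)
  have "set us \<subseteq> set ts \<Longrightarrow> P (Node a us)" for us
    by (induction us) (use assms Node in auto)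
  then show ?case by simp
qed

lemma child_of_Leaf [simp]: "\<not> child_of (Node a []) q c"
  by (simp add: child_of_def)

lemma child_of_Node:
  "child_of (Node a ts) q c \<longleftrightarrow>
     q = a \<and> c \<in> root ` set ts \<or> (\<exists>s\<in>set ts. child_of s q c)"
  unfolding child_of_def by auto

lemma child_of_Cons:
  "child_of (Node a (s # ss)) q c \<longleftrightarrow>
     q = a \<and> c = root s \<or> child_of s q c \<or> child_of (Node a ss) q c"
  by (auto simp: child_of_Node)

text \<open>With \<open>child_of_Cons\<close>, this is the binary view of a plane tree behind
  \<open>ntree_induct\<close>: the first subtree against the same root with the remaining
  subtrees.\<close>

lemma postorder_Cons: "postorder (Node a (s # ss)) = postorder s @ postorder (Node a ss)"
  by simp

lemma postorder_neq_Nil [simp]: "postorder t \<noteq> []"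
  by (cases t) simp

lemma last_postorder: "last (postorder t) = root t"
  by (cases t) simp

lemma root_in_postorder: "root t \<in> set (postorder t)"
  by (cases t) simp

lemma child_of_in_postorder:
  "child_of t q c \<Longrightarrow> q \<in> set (postorder t) \<and> c \<in> set (postorder t)"
proof (induction t rule: ntree_induct)
  case (Cons a s ss)
  then show ?case
    using root_in_postorder[of s] root_in_postorder[of "Node a ss"] unfolding child_of_Cons by auto
qed simp

lemma child_of_iff_subtrees:
  "(\<forall>s \<in> subtrees t. \<forall>s' \<in> set (children s). root s' < root s) \<longleftrightarrow>
   (\<forall>q c. child_of t q c \<longrightarrow> c < q)"
  unfolding child_of_def by blast

text \<open>The second clause says that the arcs from \<open>i\<close> to \<open>p i\<close>, drawn
  above the line of positions, do not cross. In a postorder numbering this expresses that subtrees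
  occupy intervals.\<close>

definition noncrossing_parents :: "nat set \<Rightarrow> (nat \<Rightarrow> nat) \<Rightarrow> bool" where
  "noncrossing_parents C p \<longleftrightarrow>
     (\<forall>i\<in>C. i \<noteq> Max C \<longrightarrow> p i \<in> C \<and> i < p i) \<and>
     (\<forall>i\<in>C. \<forall>j\<in>C. i \<noteq> Max C \<longrightarrow> i < j \<longrightarrow> j < p i \<longrightarrow> p j \<le> p i)"

text \<open>The vertices are numbered by the elements of \<open>C\<close>, the root being \<open>Max C\<close>; vertex \<open>i\<close> has
  the label \<open>f i\<close> and the parent \<open>p i\<close>.\<close>
definition parents_along :: "'a ntree \<Rightarrow> (nat \<Rightarrow> 'a) \<Rightarrow> nat set \<Rightarrow> (nat \<Rightarrow> nat) \<Rightarrow> bool" where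
  "parents_along t f C p \<longleftrightarrow>
     (\<forall>q c. child_of t q c \<longleftrightarrow> (\<exists>i\<in>C. i \<noteq> Max C \<and> q = f (p i) \<and> c = f i))"

lemma upt_split_append:
  assumes "map f [l..<r] = xs @ ys" "l \<le> r"
  shows "xs = map f [l..<l + length xs]" "ys = map f [l + length xs..<r]" "l + length xs \<le> r"
proof -
  have "length (map f [l..<r]) = length (xs @ ys)" using assms(1) by simp
  then have len: "r - l = length xs + length ys" by simp
  then show le: "l + length xs \<le> r" using assms(2) by linarith
  have "[l..<r] = [l..<l + length xs] @ [l + length xs..<r]"
    using le by (metis le_add1 le_add_diff_inverse upt_add_eq_append)
  then have "map f [l..<l + length xs] @ map f [l + length xs..<r] = xs @ ys"
    using assms(1) by simp
  then show "xs = map f [l..<l + length xs]" "ys = map f [l + length xs..<r]"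
    by (auto simp: append_eq_append_conv)
qed

lemma Max_interval: "l \<le> m \<Longrightarrow> Max {l..m} = (m :: nat)"
  by (intro Max_eqI) auto

lemma parents_along_interval:
  assumes "l \<le> m"
  shows "parents_along t f {l..m} p \<longleftrightarrow>
    (\<forall>q c. child_of t q c \<longleftrightarrow> (\<exists>i. l \<le> i \<and> i < m \<and> q = f (p i) \<and> c = f i))"
proof -
  have "(\<exists>i\<in>{l..m}. i \<noteq> Max {l..m} \<and> P i) \<longleftrightarrow> (\<exists>i. l \<le> i \<and> i < m \<and> P i)" for P
    using Max_interval[OF assms] by (auto simp: less_le)
  then show ?thesis by (simp add: parents_along_def)
qed

lemma noncrossing_parents_interval:
  assumes "l \<le> m"
  shows "noncrossing_parents {l..m} p \<longleftrightarrow>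
    (\<forall>i. l \<le> i \<longrightarrow> i < m \<longrightarrow> i < p i \<and> p i \<le> m \<and> (\<forall>j. i < j \<longrightarrow> j < p i \<longrightarrow> p j \<le> p i))"
    (is "?L \<longleftrightarrow> ?R")
proof -
  have "noncrossing_parents {l..m} p \<longleftrightarrow>
    (\<forall>i. l \<le> i \<and> i < m \<longrightarrow> i < p i \<and> p i \<le> m) \<and>
    (\<forall>i j. l \<le> i \<and> i < m \<and> i < j \<and> j \<le> m \<and> j < p i \<longrightarrow> p j \<le> p i)"
    unfolding noncrossing_parents_def Max_interval[OF assms]
    by (intro arg_cong2[of _ _ _ _ "(\<and>)"] iff_allI) (auto simp: Ball_def less_le)
  also have "\<dots> \<longleftrightarrow> ?R"
    by (meson less_imp_le order.trans)
  finally show ?thesis .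
qed

text \<open>The first subtree fills an initial segment \<open>l..c\<close> and the remaining tree
  fills the rest, with the root at \<open>m\<close>. The two parent maps are glued by the single new
  edge from \<open>c\<close> to \<open>m\<close>.\<close>

lemma parents_of_tree:
  assumes "postorder t = map f [l..<Suc m]" "l \<le> m"
  shows "\<exists>p. noncrossing_parents {l..m} p \<and> parents_along t f {l..m} p"
  using assms
proof (induction t arbitrary: l m rule: ntree_induct)
  case (Leaf a)
  have "length [l..<Suc m] = 1"
    using arg_cong[where f = length, OF Leaf(1)] by (metis One_nat_def append_Nil concat.simps(1)
      length_map list.map(1) list.size(3,4) postorder.simps plus_nat.add_0)
  then have "l = m" using Leaf(2) by (simp del: upt_Suc)
  then show ?case by (simp add: noncrossing_parents_def parents_along_def)
next
  case (Cons a s ss)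
  let ?A = "postorder s" and ?B = "postorder (Node a ss)"
  have split: "map f [l..<Suc m] = ?A @ ?B"
    using Cons.prems(1) by (simp only: postorder_Cons)
  obtain c where c: "l + length ?A = Suc c" "l \<le> c"
    by (metis add_Suc_right append_Nil le_add1 length_0_conv not0_implies_Suc postorder_neq_Nil)
  have A: "?A = map f [l..<Suc c]" and B: "?B = map f [Suc c..<Suc m]" and "Suc c \<le> Suc m"
    using upt_split_append[OF split] Cons.prems(2) c by auto
  moreover have "Suc c \<noteq> Suc m" using B postorder_neq_Nil[of "Node a ss"] by fastforce
  ultimately have cm: "Suc c \<le> m" by linarith
  obtain p1 where p1: "noncrossing_parents {l..c} p1" "parents_along s f {l..c} p1"
    using Cons.IH(1)[OF A c(2)] by blast
  obtain p2 where p2: "noncrossing_parents {Suc c..m} p2" "parents_along (Node a ss) f {Suc c..m} p2"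
    using Cons.IH(2)[OF B cm] by blast
  define p where "p i = (if i < c then p1 i else if i = c then m else p2 i)" for i
  have root_s: "root s = f c" using last_postorder[of s] A c(2) by simp
  have root: "a = f m" using last_postorder[of "Node a ss"] B cm by simp
  have ncp1: "i < p1 i" "p1 i \<le> c" "\<And>j. i < j \<Longrightarrow> j < p1 i \<Longrightarrow> p1 j \<le> p1 i"
    if "l \<le> i" "i < c" for i
    using p1(1) c(2) that by (auto simp: noncrossing_parents_interval)
  have ncp2: "i < p2 i" "p2 i \<le> m" "\<And>j. i < j \<Longrightarrow> j < p2 i \<Longrightarrow> p2 j \<le> p2 i"
    if "c < i" "i < m" for i
    using p2(1) cm that by (auto simp: noncrossing_parents_interval)
  have "noncrossing_parents {l..m} p"
    unfolding noncrossing_parents_interval[OF Cons.prems(2)]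
  proof (intro allI impI)
    fix i assume i: "l \<le> i" "i < m"
    consider "i < c" | "i = c" | "c < i" by linarith
    then show "i < p i \<and> p i \<le> m \<and> (\<forall>j. i < j \<longrightarrow> j < p i \<longrightarrow> p j \<le> p i)"
    proof cases
      case 1
      have "p j \<le> p i" if "i < j" "j < p i" for j
        using 1 i that ncp1(2,3)[of i] by (simp add: p_def)
      moreover have "i < p i" "p i \<le> m" using 1 i ncp1(1,2)[of i] cm by (simp_all add: p_def)
      ultimately show ?thesis by blast
    next
      case 2
      then show ?thesis using i ncp2(2) by (auto simp: p_def)
    next
      case 3
      then show ?thesis using i ncp2[of i] by (auto simp: p_def)
    qed
  qed
  moreover have "parents_along (Node a (s # ss)) f {l..m} p"
    unfolding parents_along_interval[OF Cons.prems(2)]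
  proof (intro allI)
    fix q x
    have "child_of (Node a (s # ss)) q x \<longleftrightarrow>
      (q = f m \<and> x = f c) \<or>
      (\<exists>i. l \<le> i \<and> i < c \<and> q = f (p1 i) \<and> x = f i) \<or>
      (\<exists>i. Suc c \<le> i \<and> i < m \<and> q = f (p2 i) \<and> x = f i)"
      using p1(2) p2(2) unfolding child_of_Cons root_s root
        parents_along_interval[OF c(2)] parents_along_interval[OF cm] by blast
    also have "\<dots> \<longleftrightarrow> (\<exists>i. l \<le> i \<and> i < m \<and> q = f (p i) \<and> x = f i)"
      (is "?L \<longleftrightarrow> ?R")
    proof
      assume ?L
      then consider "q = f m \<and> x = f c"
        | i where "l \<le> i" "i < c" "q = f (p1 i)" "x = f i"
        | i where "Suc c \<le> i" "i < m" "q = f (p2 i)" "x = f i"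
        by blast
      then show ?R
      proof cases
        case 1
        then show ?thesis using c(2) cm by (intro exI[of _ c]) (auto simp: p_def)
      next
        case (2 i)
        then show ?thesis using cm by (intro exI[of _ i]) (auto simp: p_def)
      next
        case (3 i)
        then show ?thesis using c(2) by (intro exI[of _ i]) (auto simp: p_def)
      qed
    next
      assume ?R
      then obtain i where i: "l \<le> i" "i < m" "q = f (p i)" "x = f i" by blast
      consider "i < c" | "i = c" | "c < i" by linarith
      then show ?L
      proof cases
        case 3
        then have "Suc c \<le> i" "q = f (p2 i)" using i by (simp_all add: p_def)
        then show ?thesis using i by blast
      qed (use i in \<open>auto simp: p_def\<close>)
    qed
    finally show "child_of (Node a (s # ss)) q x \<longleftrightarrow>
      (\<exists>i. l \<le> i \<and> i < m \<and> q = f (p i) \<and> x = f i)" .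
  qed
  ultimately show ?case by blast
qed

lemma sorted_list_of_set_split:
  fixes C :: "nat set"
  assumes "finite C"
  shows "sorted_list_of_set C =
    sorted_list_of_set {i\<in>C. i \<le> c} @ sorted_list_of_set {i\<in>C. c < i}"
proof (rule sorted_distinct_set_unique)
  show "distinct (sorted_list_of_set {i\<in>C. i \<le> c} @ sorted_list_of_set {i\<in>C. c < i})"
    using assms by auto
  show "sorted (sorted_list_of_set {i\<in>C. i \<le> c} @ sorted_list_of_set {i\<in>C. c < i})"
    using assms by (auto simp: sorted_append)
qed (use assms in auto)

lemma last_sorted_list_of_set:
  fixes X :: "nat set"
  assumes "finite X" "X \<noteq> {}"
  shows "last (sorted_list_of_set X) = Max X"
proof -
  have "sorted_list_of_set X \<noteq> []" using assms by simp
  then obtain ys y where y: "sorted_list_of_set X = ys @ [y]" by (metis append_butlast_last_id)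
  then have "sorted (ys @ [y])" by (metis sorted_sorted_list_of_set)
  moreover have "X = set (ys @ [y])" using y assms(1) by (metis set_sorted_list_of_set)
  ultimately have "Max X = y" by (intro Max_eqI) (auto simp: sorted_append)
  then show ?thesis using y by simp
qed

text \<open>Converse gluing: cut after the first child \<open>c\<close> of the root. The positions
  up to \<open>c\<close> form the first subtree, the others a smaller tree with the same
  root.\<close>

lemma tree_of_parents:
  assumes "finite C" "C \<noteq> {}" "noncrossing_parents C p"
  shows "\<exists>t. postorder t = map f (sorted_list_of_set C) \<and> parents_along t f C p"
  using assms
proof (induction "card C" arbitrary: C rule: less_induct)
  case less
  note fin = less.prems(1)
  define m where "m = Max C"
  have m: "m \<in> C" "\<And>i. i \<in> C \<Longrightarrow> i \<le> m" using less.prems by (auto simp: m_def)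
  have p: "p i \<in> C" "i < p i" if "i \<in> C" "i \<noteq> m" for i
    using less.prems(3) that by (auto simp: noncrossing_parents_def m_def)
  have nc: "p j \<le> p i" if "i \<in> C" "i \<noteq> m" "j \<in> C" "i < j" "j < p i" for i j
    using less.prems(3) that by (auto simp: noncrossing_parents_def m_def)
  show ?case
  proof (cases "C = {m}")
    case True
    have "parents_along (Node (f m) []) f {m} p" by (simp add: parents_along_def)
    then show ?thesis using True by (intro exI[of _ "Node (f m) []"]) auto
  next
    case False
    define K where "K = {i\<in>C. i \<noteq> m \<and> p i = m}"
    \<comment> \<open>The largest position below the root has nowhere to go but to the root.\<close>
    have "K \<noteq> {}"
    proof -
      define k where "k = Max (C - {m})"
      have ne: "C - {m} \<noteq> {}" "finite (C - {m})" using False m fin by auto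
      then have k: "k \<in> C - {m}" unfolding k_def by (metis Max_in)
      have "p k = m"
      proof (rule ccontr)
        assume "p k \<noteq> m"
        then have "p k \<le> k" using p k ne unfolding k_def by (intro Max_ge) auto
        then show False using p(2)[of k] k by auto
      qed
      then show ?thesis using k by (auto simp: K_def)
    qed
    have finK: "finite K" using fin by (simp add: K_def)
    define c where "c = Min K"
    have "c \<in> K" unfolding c_def using Min_in finK \<open>K \<noteq> {}\<close> by blast
    then have c: "c \<in> C" "c \<noteq> m" "p c = m" by (auto simp: K_def)
    have cmin: "c \<le> i" if "i \<in> C" "i \<noteq> m" "p i = m" for i
      unfolding c_def using that finK by (intro Min_le) (auto simp: K_def)
    have cm: "c < m" using c m by (simp add: le_neq_implies_less)
    let ?A = "{i\<in>C. i \<le> c}" and ?B = "{i\<in>C. c < i}"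
    have MA: "Max ?A = c" using c fin by (intro Max_eqI) auto
    have MB: "Max ?B = m" using m cm fin by (intro Max_eqI) auto
    \<comment> \<open>An arc from \<open>i\<close> beyond \<open>c\<close> would have to enclose the
      arc from \<open>c\<close> to \<open>m\<close>, so \<open>i\<close> would be an earlier child
      of the root.\<close>
    have pA: "p i \<le> c" if "i \<in> C" "i < c" for i
    proof (rule ccontr)
      assume "\<not> p i \<le> c"
      then have "m \<le> p i" using nc[of i c] that c cm by auto
      then have "p i = m" using p m that cm by (simp add: le_antisym)
      then show False using cmin[of i] that cm by auto
    qed
    have ncA: "noncrossing_parents ?A p"
      unfolding noncrossing_parents_def MA using p nc pA cm by force
    have ncB: "noncrossing_parents ?B p"
      unfolding noncrossing_parents_def MB using p nc cm by force
    have "m \<in> C - ?A" using m cm by simp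
    then have "card ?A < card C" using fin by (intro psubset_card_mono) blast+
    then obtain s where s: "postorder s = map f (sorted_list_of_set ?A)" "parents_along s f ?A p"
      using less.hyps[of ?A] ncA fin c by auto
    have "c \<in> C - ?B" using c by simp
    then have "card ?B < card C" using fin by (intro psubset_card_mono) blast+
    then obtain t where t: "postorder t = map f (sorted_list_of_set ?B)" "parents_along t f ?B p"
      using less.hyps[of ?B] ncB fin m cm by auto
    have neA: "?A \<noteq> {}" and neB: "?B \<noteq> {}" using c m cm by blast+
    have LA: "last (sorted_list_of_set ?A) = c" "sorted_list_of_set ?A \<noteq> []"
      using last_sorted_list_of_set[OF _ neA] MA fin neA by simp_all
    have LB: "last (sorted_list_of_set ?B) = m" "sorted_list_of_set ?B \<noteq> []"
      using last_sorted_list_of_set[OF _ neB] MB fin neB by simp_all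
    obtain a ss where t_eq: "t = Node a ss" by (cases t)
    have "root s = f c"
      using last_postorder[of s] s(1) LA by (simp add: last_map)
    moreover have "a = f m"
      using last_postorder[of t] LB t(1) t_eq by (metis last_map ntree.sel(1))
    moreover have "child_of s q x \<longleftrightarrow> (\<exists>i\<in>C. i < c \<and> q = f (p i) \<and> x = f i)" for q x
      using s(2) unfolding parents_along_def MA by force
    moreover have "child_of t q x \<longleftrightarrow> (\<exists>i\<in>C. i \<noteq> m \<and> c < i \<and> q = f (p i) \<and> x = f i)" for q x
      using t(2) unfolding parents_along_def MB by force
    ultimately have "child_of (Node a (s # ss)) q x \<longleftrightarrow>
       q = f m \<and> x = f c \<or> (\<exists>i\<in>C. i < c \<and> q = f (p i) \<and> x = f i) \<or>
       (\<exists>i\<in>C. i \<noteq> m \<and> c < i \<and> q = f (p i) \<and> x = f i)" for q x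
      unfolding child_of_Cons t_eq by auto
    then have "child_of (Node a (s # ss)) q x \<longleftrightarrow> (\<exists>i\<in>C. i \<noteq> m \<and> q = f (p i) \<and> x = f i)" for q x
      using c cm by (metis linorder_neqE_nat order_less_asym)
    then have "parents_along (Node a (s # ss)) f C p"
      by (simp add: parents_along_def m_def)
    moreover have "postorder (Node a (s # ss)) = map f (sorted_list_of_set C)"
      unfolding postorder_Cons sorted_list_of_set_split[OF fin, of c] using s(1) t(1) t_eq by simp
    ultimately show ?thesis by blast
  qed
qed

section \<open>Trees built by attaching first children\<close>

lemma root_attach_first [simp]: "root (attach_first a b t) = root t"
  by (cases t) simp

lemma in_postorder_attach_first:
  "x \<in> set (postorder (attach_first a b t)) \<longleftrightarrow>
     x \<in> set (postorder t) \<or> x = a \<and> b \<in> set (postorder t)"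
proof (induction t)
  case (Node c ts)
  then show ?case by (auto cong: bex_cong)
qed

lemma attach_first_absent: "b \<notin> set (postorder t) \<Longrightarrow> attach_first a b t = t"
  by (induction t) (auto intro!: map_idI)

lemma child_of_attach_first:
  "child_of (attach_first a b t) q c \<longleftrightarrow>
     child_of t q c \<or> (q = b \<and> c = a \<and> b \<in> set (postorder t))"
proof (induction t)
  case (Node r ts)
  have "root ` attach_first a b ` set ts = root ` set ts" by (simp add: image_image)
  then have "child_of (attach_first a b (Node r ts)) q c \<longleftrightarrow>
      q = r \<and> (c \<in> root ` set ts \<or> r = b \<and> c = a) \<or>
      (\<exists>s\<in>set ts. child_of (attach_first a b s) q c)"
    by (cases "r = b") (simp_all add: child_of_Node, blast+)
  moreover have "(\<exists>s\<in>set ts. child_of (attach_first a b s) q c) \<longleftrightarrow>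
      (\<exists>s\<in>set ts. child_of s q c) \<or> q = b \<and> c = a \<and> (\<exists>s\<in>set ts. b \<in> set (postorder s))"
    using Node by blast
  ultimately show ?case by (simp add: child_of_Node) blast
qed

text \<open>Descending through leftmost children ends at a leaf, which is read first and is the
  first child of its parent. Distinct labels ensure that \<open>attach_first\<close> puts it back in
  one place only.\<close>

lemma detach_first_leaf:
  assumes "distinct (postorder t)" "length (postorder t) \<noteq> 1"
  shows "\<exists>x q t'. postorder t = x # postorder t' \<and> t = attach_first x q t' \<and> child_of t q x"
  using assms
proof (induction t rule: ntree_induct)
  case (Leaf a)
  then show ?case by simp
next
  case (Cons a s ss)
  have dist: "distinct (postorder s)" "a \<notin> set (postorder s)"
    "set (postorder s) \<inter> set (postorder (Node a ss)) = {}"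
    "a \<notin> (\<Union>u\<in>set ss. set (postorder u))"
    using Cons.prems(1) by auto
  have absent: "map (attach_first x q) ss = ss"
    if "q \<notin> (\<Union>u\<in>set ss. set (postorder u))" for x q
    using that by (auto intro!: map_idI attach_first_absent)
  show ?case
  proof (cases "length (postorder s) = 1")
    case True
    obtain b us where s: "s = Node b us" by (cases s)
    have "us = []" using True s by (cases us) auto
    then have "Node a (s # ss) = attach_first b a (Node a ss)"
      using s absent[OF dist(4)] by simp
    moreover have "postorder (Node a (s # ss)) = b # postorder (Node a ss)"
      using s \<open>us = []\<close> by simp
    moreover have "child_of (Node a (s # ss)) a b" using s by (simp add: child_of_Cons)
    ultimately show ?thesis by blast
  next
    case False
    then obtain x q s' where s': "postorder s = x # postorder s'" "s = attach_first x q s'"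
      "child_of s q x" using Cons.IH(1) dist by blast
    have q: "q \<in> set (postorder s)" using child_of_in_postorder[OF s'(3)] by simp
    then have "q \<noteq> a" "q \<notin> (\<Union>u\<in>set ss. set (postorder u))" using dist by auto
    then have "Node a (s # ss) = attach_first x q (Node a (s' # ss))"
      using absent s'(2) by simp
    moreover have "postorder (Node a (s # ss)) = x # postorder (Node a (s' # ss))"
      using s'(1) by simp
    moreover have "child_of (Node a (s # ss)) q x" using s'(3) by (simp add: child_of_Cons)
    ultimately show ?thesis by blast
  qed
qed

text \<open>Makes the definite description in \<open>parent\<close> usable. Numbering the vertices
  by the indices of the word itself turns the parent map on positions into a function of labels,
  since the labels are distinct.\<close>

lemma parent_in_tree:
  assumes "distinct (postorder t)"
  shows "child_of t q c \<Longrightarrow> parent t c = q"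
    and "child_of t q c \<Longrightarrow> q \<noteq> c"
    and "c \<in> set (postorder t) \<Longrightarrow> c \<noteq> last (postorder t) \<Longrightarrow> child_of t (parent t c) c"
proof -
  let ?w = "postorder t"
  obtain m where m: "length ?w = Suc m" by (metis length_0_conv not0_implies_Suc postorder_neq_Nil)
  have w: "?w = map ((!) ?w) [0..<Suc m]" using m map_nth[of ?w] by metis
  obtain p where nc: "noncrossing_parents {0..m} p" and p: "parents_along t ((!) ?w) {0..m} p"
    using parents_of_tree[OF w] by auto
  have ch: "child_of t q c \<longleftrightarrow> (\<exists>i<m. q = ?w ! p i \<and> c = ?w ! i)" for q c
    using p by (simp add: parents_along_interval)
  have pm: "i < p i \<and> p i < length ?w" if "i < m" for i
    using nc that m by (auto simp: noncrossing_parents_interval less_Suc_eq_le)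
  have inj: "?w ! i = ?w ! j \<longleftrightarrow> i = j" if "i < Suc m" "j < Suc m" for i j
    using nth_eq_iff_index_eq[OF assms] that m by simp
  show par: "parent t c = q" if "child_of t q c" for q c
    unfolding parent_def using that ch inj by (intro the_equality) (auto simp: less_Suc_eq)
  show "q \<noteq> c" if "child_of t q c"
    using that ch pm inj m by (metis less_Suc_eq less_irrefl)
  assume c: "c \<in> set ?w" "c \<noteq> last ?w"
  then obtain i where "i < Suc m" "c = ?w ! i" using m by (metis in_set_conv_nth)
  moreover have "last ?w = ?w ! m" using m by (simp add: last_conv_nth)
  ultimately have "child_of t (?w ! p i) c" using ch c by (metis less_Suc_eq)
  then show "child_of t (parent t c) c" using par by simp
qed

lemma child_of_detach:
  assumes "distinct (x # postorder t)" "t' = attach_first x q t" "child_of t' q x"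
  shows "child_of t r c \<longleftrightarrow> child_of t' r c \<and> c \<noteq> x"
  using assms child_of_in_postorder[of t] by (auto simp: child_of_attach_first)

text \<open>The first leaf of both trees is the same label under the same parent; removing it leaves
  trees that again agree in word and edges.\<close>

lemma tree_eqI:
  assumes "distinct (postorder t)" "postorder t' = postorder t"
    and "\<And>q c. child_of t' q c \<longleftrightarrow> child_of t q c"
  shows "t' = t"
  using assms
proof (induction "length (postorder t)" arbitrary: t t' rule: less_induct)
  case less
  show ?case
  proof (cases "length (postorder t) = 1")
    case True
    then have "\<exists>a. u = Node a []" if "postorder u = postorder t" for u
    proof (cases u)
      case (Node a us)
      then show ?thesis using that True by (cases us) (auto dest!: arg_cong[of _ _ length])
    qed
    then obtain a b where "t = Node a []" "t' = Node b []" using less.prems(2) by metis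
    then show ?thesis using less.prems(2) by simp
  next
    case False
    obtain x q u where u: "postorder t = x # postorder u" "t = attach_first x q u" "child_of t q x"
      using detach_first_leaf[OF less.prems(1) False] by blast
    obtain x' q' u' where u': "postorder t' = x' # postorder u'" "t' = attach_first x' q' u'"
      "child_of t' q' x'"
      using detach_first_leaf[of t'] less.prems False by metis
    have "x' = x" "postorder u' = postorder u" using u(1) u'(1) less.prems(2) by auto
    have "q' = q" using parent_in_tree(1)[OF less.prems(1)] u(3) u'(3) less.prems(3) \<open>x' = x\<close> by metis
    have "child_of u' r c \<longleftrightarrow> child_of u r c" for r c
      using child_of_detach[OF _ u(2,3)] child_of_detach[OF _ u'(2,3)] less.prems u(1) u'(1) \<open>x' = x\<close>
      by simp
    then have "u' = u" using less.hyps[of u u'] less.prems(1) u(1) \<open>postorder u' = postorder u\<close> by simp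
    then show ?thesis using u(2) u'(2) \<open>x' = x\<close> \<open>q' = q\<close> by simp
  qed
qed

section \<open>The equation defining the map g as a system of parent conditions\<close>

lemma vertices_g_aux:
  assumes "k < n"
  shows "set (postorder (g_aux n \<pi> Hs Ts k)) \<subseteq> \<pi> ` {n - k..n}"
  using assms
proof (induction k)
  case (Suc k)
  have "set (postorder (g_aux n \<pi> Hs Ts (Suc k))) \<subseteq>
      insert (\<pi> (n - Suc k)) (set (postorder (g_aux n \<pi> Hs Ts k)))"
    by (auto simp: in_postorder_attach_first)
  also have "\<dots> \<subseteq> insert (\<pi> (n - Suc k)) (\<pi> ` {n - k..n})"
    using Suc by (intro insert_mono) simp
  also have "\<dots> = \<pi> ` (insert (n - Suc k) {n - k..n})" by simp
  also have "\<dots> \<subseteq> \<pi> ` {n - Suc k..n}" by (intro image_mono) auto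
  finally show ?case .
qed simp

text \<open>A vertex that is present at the end must have been attached when its turn came, because
  \<^const>\<open>attach_first\<close> silently does nothing if the attachment point is absent.\<close>
lemma child_of_g_aux:
  assumes "inj_on \<pi> {1..n}" "k < n" "l \<in> {n - k..<n}" "\<pi> l \<in> set (postorder (g_aux n \<pi> Hs Ts k))"
  shows "child_of (g_aux n \<pi> Hs Ts k) (attach_point \<pi> Hs Ts l) (\<pi> l)"
  using assms(2-4)
proof (induction k)
  case (Suc k)
  let ?t = "g_aux n \<pi> Hs Ts k" and ?l = "n - Suc k"
  have sub: "set (postorder ?t) \<subseteq> \<pi> ` {n - k..n}" using Suc.prems(1) by (intro vertices_g_aux) simp
  have "\<pi> ?l \<notin> set (postorder ?t)"
  proof
    assume "\<pi> ?l \<in> set (postorder ?t)"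
    then have "\<pi> ?l \<in> \<pi> ` {n - k..n}" using sub by (rule subsetD[rotated])
    then obtain j where j: "j \<in> {n - k..n}" "\<pi> ?l = \<pi> j" by (rule imageE)
    have "?l \<in> {1..n}" "j \<in> {1..n}" using j(1) Suc.prems(1) by auto
    then have "?l = j" using j(2) inj_onD[OF assms(1)] by blast
    then show False using j(1) Suc.prems(1) by auto
  qed
  then show ?case
  proof (cases "l = ?l")
    case True
    then have "attach_point \<pi> Hs Ts ?l \<in> set (postorder ?t)"
      using Suc.prems(3) \<open>\<pi> ?l \<notin> set (postorder ?t)\<close> by (simp add: in_postorder_attach_first)
    then show ?thesis using True by (simp add: child_of_attach_first)
  next
    case False
    then have l: "l \<in> {n - k..<n}" using Suc.prems(2) by auto
    have "l \<in> {1..n}" "?l \<in> {1..n}" using l Suc.prems(1) by auto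
    then have "\<pi> l \<noteq> \<pi> ?l" using False inj_onD[OF assms(1)] by blast
    then have "\<pi> l \<in> set (postorder ?t)"
      using Suc.prems(3) by (simp add: in_postorder_attach_first)
    then have "child_of ?t (attach_point \<pi> Hs Ts l) (\<pi> l)"
      using Suc.IH l Suc.prems(1) by simp
    then show ?thesis by (simp add: child_of_attach_first)
  qed
qed simp

text \<open>The construction is undone step by step: the first letter of the word is the leaf
  attached last, and its parent is the prescribed attachment point.\<close>

lemma g_aux_eqI:
  assumes "distinct (postorder t)" "postorder t = map \<pi> [n - k..<Suc n]" "k < n"
    and "\<And>l. l \<in> {n - k..<n} \<Longrightarrow> child_of t (attach_point \<pi> Hs Ts l) (\<pi> l)"
  shows "t = g_aux n \<pi> Hs Ts k"
  using assms
proof (induction k arbitrary: t)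
  case 0
  obtain a ts where t: "t = Node a ts" by (cases t)
  have "postorder t = [\<pi> n]" using "0.prems"(2) by simp
  then show ?case using t by (cases ts) auto
next
  case (Suc k)
  let ?l = "n - Suc k"
  have l: "?l < n" "Suc ?l = n - k" using Suc.prems(3) by auto
  have w: "postorder t = \<pi> ?l # map \<pi> [n - k..<Suc n]"
    using Suc.prems(2) l by (simp add: upt_conv_Cons del: upt_Suc)
  have len: "length (postorder t) \<noteq> 1" using w l by (simp del: upt_Suc)
  obtain x q u where u: "postorder t = x # postorder u" "t = attach_first x q u" "child_of t q x"
    using detach_first_leaf[OF Suc.prems(1) len] by blast
  have xu: "x = \<pi> ?l" "postorder u = map \<pi> [n - k..<Suc n]" using u(1) w by auto
  have "child_of t (attach_point \<pi> Hs Ts ?l) x"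
    using Suc.prems(4)[of ?l] l xu by simp
  then have q: "q = attach_point \<pi> Hs Ts ?l"
    using parent_in_tree(1)[OF Suc.prems(1)] u(3) by metis
  have du: "distinct (x # postorder u)" using Suc.prems(1) u(1) by simp
  have "u = g_aux n \<pi> Hs Ts k"
  proof (rule Suc.IH)
    show "distinct (postorder u)" using du by simp
    show "postorder u = map \<pi> [n - k..<Suc n]" by (rule xu)
    show "k < n" using Suc.prems(3) by simp
    fix i assume i: "i \<in> {n - k..<n}"
    then have "\<pi> i \<in> set (postorder u)" using xu(2) by auto
    then have "\<pi> i \<noteq> x" using du by auto
    moreover have "child_of t (attach_point \<pi> Hs Ts i) (\<pi> i)" using Suc.prems(4)[of i] i by auto
    ultimately show "child_of u (attach_point \<pi> Hs Ts i) (\<pi> i)"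
      using child_of_detach[OF du u(2,3)] by blast
  qed
  then show ?case using u(2) q xu by simp
qed

text \<open>Holds for arbitrary \<open>Hs\<close> and \<open>Ts\<close>: in the forward direction
  the word of \<open>t\<close> already shows that every attachment succeeded. All later reasoning
  about g goes through this equivalence.\<close>

lemma g_map_eq_iff:
  assumes "1 \<le> n" "inj_on \<pi> {1..n}" "postorder t = word_of n \<pi>"
  shows "t = g_map n \<pi> Hs Ts \<longleftrightarrow>
    (\<forall>l\<in>{1..<n}. child_of t (attach_point \<pi> Hs Ts l) (\<pi> l))"
proof
  assume t: "t = g_map n \<pi> Hs Ts"
  have "\<pi> l \<in> set (postorder t)" if "l \<in> {1..<n}" for l
    using that assms(3) by (auto simp: word_of_def)
  then show "\<forall>l\<in>{1..<n}. child_of t (attach_point \<pi> Hs Ts l) (\<pi> l)"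
    using child_of_g_aux[OF assms(2), of "n - 1"] assms(1) unfolding t g_map_def by auto
next
  assume ch: "\<forall>l\<in>{1..<n}. child_of t (attach_point \<pi> Hs Ts l) (\<pi> l)"
  have eq: "n - (n - 1) = 1" using assms(1) by simp
  have "set [1..<Suc n] = {1..n}" by auto
  then have "distinct (postorder t)"
    unfolding assms(3) word_of_def distinct_map using assms(2) by (metis distinct_upt)
  then show "t = g_map n \<pi> Hs Ts" unfolding g_map_def
    by (rule g_aux_eqI) (use assms ch eq in \<open>auto simp: word_of_def simp del: upt_Suc\<close>)
qed

section \<open>Valid hook configurations and their colors\<close>

lemma overlap_iff:
  assumes "i < j" "i' < j'"
  shows "(\<exists>x y. x \<noteq> y \<and> {x, y} \<subseteq> real_interval (i, j) \<inter> real_interval (i', j')) \<longleftrightarrow>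
    i < j' \<and> i' < j"
proof
  assume "i < j' \<and> i' < j"
  then have "max (real i) (real i') < min (real j) (real j')" using assms by simp
  then have "max (real i) (real i') \<noteq> min (real j) (real j')"
    "{max (real i) (real i'), min (real j) (real j')} \<subseteq> real_interval (i, j) \<inter> real_interval (i', j')"
    using assms by (auto simp: real_interval_def)
  then show "\<exists>x y. x \<noteq> y \<and> {x, y} \<subseteq> real_interval (i, j) \<inter> real_interval (i', j')" by blast
next
  assume "\<exists>x y. x \<noteq> y \<and> {x, y} \<subseteq> real_interval (i, j) \<inter> real_interval (i', j')"
  then obtain x y where "x \<noteq> y" "real i \<le> x" "x \<le> real j" "real i \<le> y" "y \<le> real j"
    "real i' \<le> x" "x \<le> real j'" "real i' \<le> y" "y \<le> real j'"
    by (auto simp: real_interval_def)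
  then have "real i < real j'" "real i' < real j" by linarith+
  then show "i < j' \<and> i' < j" by simp
qed

lemma real_interval_subset_iff:
  "i < j \<Longrightarrow> real_interval (i, j) \<subseteq> real_interval (i', j') \<longleftrightarrow> i' \<le> i \<and> j \<le> j'"
  by (auto simp: real_interval_def)

text \<open>Real intervals and diagram points disappear, because a point of the diagram is
  determined by its first coordinate and overlap in more than one point is a pair of strict
  inequalities.\<close>

lemma valid_hook_configs_iff:
  "Hs \<in> valid_hook_configs n \<pi> \<longleftrightarrow>
     (\<forall>i j. (i, j) \<in> set Hs \<longrightarrow> 1 \<le> i \<and> i < j \<and> j \<le> n \<and> \<pi> i < \<pi> j) \<and>
     sorted_wrt (<) (map fst Hs) \<and>
     (\<forall>i. 1 \<le> i \<and> i < n \<and> \<pi> (Suc i) < \<pi> i \<longrightarrow> (\<exists>j. (i, j) \<in> set Hs)) \<and>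
     (\<forall>i j. (i, j) \<in> set Hs \<longrightarrow>
       (\<exists>d. 1 \<le> d \<and> d < n \<and> \<pi> (Suc d) < \<pi> d \<and> (d, j) \<in> set Hs) \<and> (j - 1, j) \<in> set Hs) \<and>
     (\<forall>i j i' j'. (i, j) \<in> set Hs \<longrightarrow> (i', j') \<in> set Hs \<longrightarrow> \<pi> j < \<pi> j' \<longrightarrow>
       i < j' \<longrightarrow> i' < j \<longrightarrow> i' \<le> i \<and> j \<le> j')"
proof -
  have hook: "(\<forall>H\<in>set Hs. is_hook n \<pi> H) \<longleftrightarrow>
    (\<forall>i j. (i, j) \<in> set Hs \<longrightarrow> 1 \<le> i \<and> i < j \<and> j \<le> n \<and> \<pi> i < \<pi> j)"
    by (auto simp: is_hook_def Ball_def split_paired_All; fastforce)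
  have b: "(\<forall>i. descent n \<pi> i \<longrightarrow> (\<exists>H\<in>set Hs. sw \<pi> H = (i, \<pi> i))) \<longleftrightarrow>
    (\<forall>i. 1 \<le> i \<and> i < n \<and> \<pi> (Suc i) < \<pi> i \<longrightarrow> (\<exists>j. (i, j) \<in> set Hs))"
    by (auto simp: descent_def sw_def Bex_def split_paired_Ex)
  have c: "(\<forall>H \<in> set Hs. \<exists>H' \<in> set Hs. \<exists>H'' \<in> set Hs.
        descent n \<pi> (fst H') \<and>
        sw \<pi> H'' = (snd H - 1, \<pi> (snd H - 1)) \<and>
        ne \<pi> H' = ne \<pi> H \<and> ne \<pi> H'' = ne \<pi> H) \<longleftrightarrow>
    (\<forall>i j. (i, j) \<in> set Hs \<longrightarrow>
       (\<exists>d. 1 \<le> d \<and> d < n \<and> \<pi> (Suc d) < \<pi> d \<and> (d, j) \<in> set Hs) \<and> (j - 1, j) \<in> set Hs)"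
  proof -
    have "(\<exists>H' \<in> set Hs. \<exists>H'' \<in> set Hs. descent n \<pi> (fst H') \<and>
        sw \<pi> H'' = (j - 1, \<pi> (j - 1)) \<and> ne \<pi> H' = (j, \<pi> j) \<and> ne \<pi> H'' = (j, \<pi> j)) \<longleftrightarrow>
      (\<exists>d. 1 \<le> d \<and> d < n \<and> \<pi> (Suc d) < \<pi> d \<and> (d, j) \<in> set Hs) \<and> (j - 1, j) \<in> set Hs"
      for j
      by (auto simp: descent_def sw_def ne_def Bex_def split_paired_Ex)
    then show ?thesis by (simp add: Ball_def split_paired_All ne_def)
  qed
  have d: "(\<forall>H \<in> set Hs. \<forall>H' \<in> set Hs.
        \<pi> (snd H) < \<pi> (snd H') \<and>
        (\<exists>x y. x \<noteq> y \<and> {x, y} \<subseteq> real_interval H \<inter> real_interval H') \<longrightarrow>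
        real_interval H \<subseteq> real_interval H') \<longleftrightarrow>
    (\<forall>i j i' j'. (i, j) \<in> set Hs \<longrightarrow> (i', j') \<in> set Hs \<longrightarrow> \<pi> j < \<pi> j' \<longrightarrow>
       i < j' \<longrightarrow> i' < j \<longrightarrow> i' \<le> i \<and> j \<le> j')" (is "?L \<longleftrightarrow> ?R")
    if "\<forall>i j. (i, j) \<in> set Hs \<longrightarrow> 1 \<le> i \<and> i < j \<and> j \<le> n \<and> \<pi> i < \<pi> j"
  proof -
    have "?L \<longleftrightarrow> (\<forall>i j i' j'. (i, j) \<in> set Hs \<longrightarrow> (i', j') \<in> set Hs \<longrightarrow>
        \<pi> j < \<pi> j' \<and> (\<exists>x y. x \<noteq> y \<and> {x, y} \<subseteq> real_interval (i, j) \<inter> real_interval (i', j')) \<longrightarrow>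
        real_interval (i, j) \<subseteq> real_interval (i', j'))"
      by (simp add: Ball_def split_paired_All del: insert_subset)
    also have "\<dots> \<longleftrightarrow> ?R"
      using that overlap_iff real_interval_subset_iff by meson
    finally show ?thesis .
  qed
  show ?thesis
    unfolding valid_hook_configs_def mem_Collect_eq hook b c using d by blast
qed

definition covering :: "hook list \<Rightarrow> nat \<Rightarrow> nat set" where
  "covering Hs k = {i. \<exists>j. (i, j) \<in> set Hs \<and> i < k \<and> k \<le> j}"

text \<open>The point in position \<open>k\<close> takes the color of the innermost hook \<open>(i, j)\<close> with
  \<open>i < k \<le> j\<close>; a class is thus identified by the southwest end \<open>i\<close> of its hook, with
  0 standing for the color \<open>c\<^sub>0\<close>.\<close>
definition innermost :: "hook list \<Rightarrow> nat \<Rightarrow> nat" where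
  "innermost Hs k = Max (insert 0 (covering Hs k))"

lemma finite_covering [simp]: "finite (covering Hs k)"
proof -
  have "covering Hs k \<subseteq> fst ` set Hs" by (force simp: covering_def)
  then show ?thesis by (rule finite_subset) simp
qed

lemma le_innermost: "(i, j) \<in> set Hs \<Longrightarrow> i < k \<Longrightarrow> k \<le> j \<Longrightarrow> i \<le> innermost Hs k"
  unfolding innermost_def by (intro Max_ge) (use finite_covering[of Hs k] in \<open>auto simp: covering_def\<close>)

lemma innermost_cases:
  obtains "innermost Hs k = 0" | j where "(innermost Hs k, j) \<in> set Hs" "innermost Hs k < k" "k \<le> j"
proof -
  have "innermost Hs k \<in> insert 0 (covering Hs k)"
    unfolding innermost_def by (rule Max_in) auto
  then show ?thesis using that by (auto simp: covering_def)
qed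

lemma innermost_less: "1 \<le> k \<Longrightarrow> innermost Hs k < k"
  by (cases rule: innermost_cases[of Hs k]) auto

lemma innermost_eqI:
  assumes "i = 0 \<or> (\<exists>j. (i, j) \<in> set Hs \<and> i < k \<and> k \<le> j)"
    and "\<And>i' j'. (i', j') \<in> set Hs \<Longrightarrow> i' < k \<Longrightarrow> k \<le> j' \<Longrightarrow> i' \<le> i"
  shows "innermost Hs k = i"
  unfolding innermost_def using assms finite_covering[of Hs k]
  by (intro Max_eqI) (auto simp: covering_def)

locale hook_config =
  fixes n :: nat and \<pi> :: "nat \<Rightarrow> nat" and Hs :: "hook list"
  assumes perm: "\<pi> permutes {1..n}"
    and valid: "Hs \<in> valid_hook_configs n \<pi>"
begin

lemma hookD:
  assumes "(i, j) \<in> set Hs"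
  shows "1 \<le> i" "i < j" "j \<le> n" "\<pi> i < \<pi> j"
    and "\<exists>d. 1 \<le> d \<and> d < n \<and> \<pi> (Suc d) < \<pi> d \<and> (d, j) \<in> set Hs"
    and "(j - 1, j) \<in> set Hs"
  using valid assms unfolding valid_hook_configs_iff by blast+

lemma sorted_Hs: "sorted_wrt (<) (map fst Hs)"
  using valid unfolding valid_hook_configs_iff by blast

lemma descent_hook: "1 \<le> i \<Longrightarrow> i < n \<Longrightarrow> \<pi> (Suc i) < \<pi> i \<Longrightarrow> \<exists>j. (i, j) \<in> set Hs"
  using valid unfolding valid_hook_configs_iff by blast

lemma nested:
  "(i, j) \<in> set Hs \<Longrightarrow> (i', j') \<in> set Hs \<Longrightarrow> \<pi> j < \<pi> j' \<Longrightarrow> i < j' \<Longrightarrow> i' < j \<Longrightarrow> i' \<le> i \<and> j \<le> j'"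
  using valid unfolding valid_hook_configs_iff by blast

lemma distinct_fst: "distinct (map fst Hs)"
  using sorted_Hs strict_sorted_iff by blast

lemma hook_unique: "(i, j) \<in> set Hs \<Longrightarrow> (i, j') \<in> set Hs \<Longrightarrow> j = j'"
  using distinct_fst by (metis eq_key_imp_eq_value)

lemma inj: "inj \<pi>"
  using perm by (rule permutes_inj)

text \<open>Crossing hooks would end at different heights, and condition (d) would nest the lower
  one inside the higher one, in either case against the order of the endpoints.\<close>

lemma hooks_noncrossing:
  assumes "(i, j) \<in> set Hs" "(i', j') \<in> set Hs" "i < i'" "i' < j"
  shows "j' \<le> j"
proof (rule ccontr)
  assume "\<not> j' \<le> j"
  then have "\<pi> j \<noteq> \<pi> j'" using inj by (auto dest: injD)
  then show False
    using nested[OF assms(1,2)] nested[OF assms(2,1)] assms \<open>\<not> j' \<le> j\<close> hookD(2)[OF assms(2)]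
    by linarith
qed

text \<open>No point lies above a hook: the last point above it would be a descent, and the hook
  starting there would violate condition (d).\<close>
lemma below_hook:
  assumes "(i, j) \<in> set Hs" "i < k" "k < j"
  shows "\<pi> k < \<pi> j"
proof (rule ccontr)
  assume "\<not> \<pi> k < \<pi> j"
  define B where "B = {b. k \<le> b \<and> b < j \<and> \<pi> j < \<pi> b}"
  have "\<pi> k \<noteq> \<pi> j" using assms(3) inj by (auto dest: injD)
  then have "k \<in> B" using \<open>\<not> \<pi> k < \<pi> j\<close> assms by (auto simp: B_def)
  moreover have fin: "finite B" by (rule finite_subset[of _ "{..j}"]) (auto simp: B_def)
  ultimately have b: "Max B \<in> B" using Max_in by blast
  define b where "b = Max B"
  have b: "k \<le> b" "b < j" "\<pi> j < \<pi> b" using b by (auto simp: B_def b_def)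
  have "Suc b \<notin> B"
    using Max_ge[OF fin, of "Suc b"] by (auto simp: b_def)
  then have "\<pi> (Suc b) \<le> \<pi> j" using b by (cases "Suc b = j") (auto simp: B_def not_less)
  then obtain j' where j': "(b, j') \<in> set Hs"
    using descent_hook[of b] b assms hookD(1,3)[OF assms(1)] by auto
  have "\<pi> j < \<pi> j'" using hookD(4)[OF j'] b by simp
  then show False
    using nested[OF assms(1) j'] assms b hookD(2)[OF j'] by linarith
qed

lemma innermost_Suc: "(i, j) \<in> set Hs \<Longrightarrow> innermost Hs (Suc i) = i"
  by (rule innermost_eqI) (use hookD in \<open>fastforce+\<close>)

lemma innermost_NE:
  assumes "(i, j) \<in> set Hs"
  shows "innermost Hs j = j - 1"
  using innermost_Suc[OF hookD(6)[OF assms]] hookD(1,2)[OF assms] by simp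

text \<open>The innermost hook over \<open>j\<close> is \<open>(j - 1, j)\<close> by condition (c),
  and it covers only \<open>j\<close>. This isolates northeast endpoints in their classes.\<close>

lemma innermost_NE_unique:
  assumes "(i, j) \<in> set Hs" "1 \<le> k" "innermost Hs k = innermost Hs j"
  shows "k = j"
proof (cases rule: innermost_cases[of Hs k])
  case 1
  then show ?thesis using assms innermost_NE[OF assms(1)] hookD(1,2)[OF assms(1)] by simp
next
  case (2 j')
  then have "j' = j" using assms innermost_NE[OF assms(1)] hookD(6)[OF assms(1)] hook_unique by metis
  then show ?thesis using 2 assms innermost_NE[OF assms(1)] by simp
qed

text \<open>Otherwise the last point of \<open>[a, b)\<close> that is at least as high as \<open>a\<close> is a descent, and its
  hook covers \<open>b\<close> but not \<open>a\<close>.\<close>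
lemma innermost_mono:
  assumes "1 \<le> a" "a < b" "b \<le> n" "innermost Hs a = innermost Hs b"
  shows "\<pi> a < \<pi> b"
proof (rule ccontr)
  assume "\<not> \<pi> a < \<pi> b"
  moreover have "\<pi> a \<noteq> \<pi> b" using assms(2) inj by (auto dest: injD)
  ultimately have ab: "\<pi> b < \<pi> a" by simp
  define D where "D = {d. a \<le> d \<and> d < b \<and> \<pi> a \<le> \<pi> d}"
  have fin: "finite D" by (rule finite_subset[of _ "{..b}"]) (auto simp: D_def)
  define d where "d = Max D"
  have "a \<in> D" using assms by (auto simp: D_def)
  then have "d \<in> D" using Max_in[OF fin] by (auto simp: d_def)
  then have d: "a \<le> d" "d < b" "\<pi> a \<le> \<pi> d" by (auto simp: D_def)
  have above: "\<pi> x < \<pi> a" if "d < x" "x \<le> b" for x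
  proof (rule ccontr)
    assume "\<not> \<pi> x < \<pi> a"
    then have "x \<in> D" using that d ab by (auto simp: D_def le_less)
    then show False using Max_ge[OF fin, of x] that by (simp add: d_def)
  qed
  then obtain j where j: "(d, j) \<in> set Hs"
    using descent_hook[of d] d assms above[of "Suc d"] by fastforce
  \<comment> \<open>The end of the hook is higher than \<open>\<pi> d\<close>, hence than
    \<open>\<pi> a\<close>, so it cannot lie in the low stretch from \<open>d + 1\<close> to
    \<open>b\<close>.\<close>
  have "b < j"
    using above[of j] hookD[OF j] d by (meson leI less_le_trans less_trans not_less_iff_gr_or_eq)
  then have "d \<le> innermost Hs b" using le_innermost[OF j] d by simp
  then show False using innermost_less[OF assms(1), of Hs] assms d by simp
qed

section \<open>Colors correspond to innermost hooks\<close>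

lemma hook_at_mem: "r \<in> {1..length Hs} \<Longrightarrow> hook_at Hs r \<in> set Hs"
  by (auto simp: hook_at_def)

lemma hook_at_ex:
  assumes "H \<in> set Hs"
  obtains r where "r \<in> {1..length Hs}" "hook_at Hs r = H"
proof -
  obtain k where "k < length Hs" "Hs ! k = H" using assms by (auto simp: in_set_conv_nth)
  then show ?thesis using that[of "Suc k"] by (simp add: hook_at_def)
qed

lemma fst_hook_at_less:
  assumes "r \<in> {1..length Hs}" "r' \<in> {1..length Hs}" "r < r'"
  shows "fst (hook_at Hs r) < fst (hook_at Hs r')"
  using sorted_wrt_nth_less[OF sorted_Hs, of "r - 1" "r' - 1"] assms by (auto simp: hook_at_def)

lemma hook_at_inj:
  assumes "r \<in> {1..length Hs}" "r' \<in> {1..length Hs}" "fst (hook_at Hs r) = fst (hook_at Hs r')"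
  shows "r = r'"
  using fst_hook_at_less[of r r'] fst_hook_at_less[of r' r] assms by (metis less_irrefl linorder_neqE_nat)

text \<open>At a northeast endpoint \<open>k\<close>, the largest index belongs to the hook
  \<open>(k - 1, k)\<close>. Elsewhere the hooks over \<open>k\<close> are nested and outer ones are
  at least as high, so the ray first meets the height of the innermost hook; the tie rule then
  selects that hook itself.\<close>

lemma color_innermost:
  assumes "k \<in> {1..n}"
  shows "(color \<pi> Hs k = 0 \<and> innermost Hs k = 0) \<or>
    (color \<pi> Hs k \<in> {1..length Hs} \<and> fst (hook_at Hs (color \<pi> Hs k)) = innermost Hs k)"
proof -
  have NE_iff: "(k, \<pi> k) \<in> NE \<pi> Hs \<longleftrightarrow> (\<exists>i. (i, k) \<in> set Hs)"
    by (force simp: NE_def ne_def)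
  consider (NE) i where "(i, k) \<in> set Hs"
    | (none) "\<nexists>i. (i, k) \<in> set Hs" "innermost Hs k = 0"
    | (cover) j where "\<nexists>i. (i, k) \<in> set Hs" "(innermost Hs k, j) \<in> set Hs" "innermost Hs k < k" "k < j"
  proof -
    have "innermost Hs k = 0 \<or> (\<exists>j. (innermost Hs k, j) \<in> set Hs \<and> innermost Hs k < k \<and> k \<le> j)"
      by (rule innermost_cases[of Hs k]) blast+
    then show ?thesis using that by (auto simp: le_less)
  qed
  then show ?thesis
  proof cases
    case NE
    let ?R = "{r \<in> {1..length Hs}. ne \<pi> (hook_at Hs r) = (k, \<pi> k)}"
    obtain r where r: "r \<in> {1..length Hs}" "hook_at Hs r = (k - 1, k)"
      using hook_at_ex[OF hookD(6)[OF NE]] by blast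
    have "Max ?R = r"
    proof (rule Max_eqI)
      fix s assume s: "s \<in> ?R"
      then have "snd (hook_at Hs s) = k" by (simp add: ne_def)
      then have "(fst (hook_at Hs s), k) \<in> set Hs" using hook_at_mem[of s] s by (cases "hook_at Hs s") auto
      then have "fst (hook_at Hs s) < k" by (rule hookD)
      then show "s \<le> r" using fst_hook_at_less[of r s] s r by (cases "r < s") auto
    qed (use r in \<open>auto simp: ne_def\<close>)
    moreover have "color \<pi> Hs k = Max ?R"
      unfolding color_def by (rule if_P) (use NE NE_iff in blast)
    ultimately have "color \<pi> Hs k = r" by simp
    then show ?thesis using r innermost_NE[OF NE] by simp
  next
    case none
    have "heights_hit \<pi> Hs k = {}"
    proof (rule ccontr)
      assume "heights_hit \<pi> Hs k \<noteq> {}"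
      then obtain i j where "(i, j) \<in> set Hs" "real i + 1/2 \<le> real k" "k \<le> j"
        by (auto simp: heights_hit_def top_part_def)
      then have "i \<le> innermost Hs k" by (intro le_innermost) auto
      then show False using none hookD(1)[OF \<open>(i, j) \<in> set Hs\<close>] by simp
    qed
    then show ?thesis using none by (simp add: color_def NE_iff)
  next
    case cover
    let ?i = "innermost Hs k"
    \<comment> \<open>At integer abscissas the offset 1/2 in the top part just means
      \<open>a < k\<close>.\<close>
    have top: "(real k, y) \<in> top_part \<pi> (a, b) \<longleftrightarrow> a < k \<and> k \<le> b \<and> y = real (\<pi> b)" for y a b
      by (auto simp: top_part_def)
    \<comment> \<open>Another hook over \<open>k\<close> starts further left, so by noncrossing it
      ends at \<open>j\<close> or passes over \<open>j\<close>, where no point rises above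
      it.\<close>
    have low: "\<pi> j \<le> \<pi> b" if "(a, b) \<in> set Hs" "a < k" "k \<le> b" for a b
    proof (cases "a = ?i")
      case True
      then show ?thesis using hook_unique that cover by auto
    next
      case False
      then have "a < ?i" using le_innermost[OF that] by simp
      then have "j \<le> b" using hooks_noncrossing[OF that(1) cover(2)] that cover by simp
      then show ?thesis
        using below_hook[OF that(1), of j] \<open>a < ?i\<close> hookD(2)[OF cover(2)] by (cases "j = b") auto
    qed
    have fin: "finite (heights_hit \<pi> Hs k)"
    proof (rule finite_subset)
      show "heights_hit \<pi> Hs k \<subseteq> (\<lambda>H. real (\<pi> (snd H))) ` set Hs"
        by (auto simp: heights_hit_def top_part_def)
    qed simp
    have in_hit: "real (\<pi> j) \<in> heights_hit \<pi> Hs k"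
    proof -
      have "(real k, real (\<pi> j)) \<in> top_part \<pi> (?i, j)" using cover by (simp only: top) simp
      then show ?thesis using cover below_hook[OF cover(2)] by (auto simp: heights_hit_def)
    qed
    have Min: "Min (heights_hit \<pi> Hs k) = real (\<pi> j)"
    proof (rule Min_eqI)
      fix y assume "y \<in> heights_hit \<pi> Hs k"
      then obtain a b where "(a, b) \<in> set Hs" "(real k, y) \<in> top_part \<pi> (a, b)"
        by (auto simp: heights_hit_def)
      then show "real (\<pi> j) \<le> y" using low[of a b] by (simp add: top)
    qed (fact fin in_hit)+
    obtain r where r: "r \<in> {1..length Hs}" "hook_at Hs r = (?i, j)"
      using hook_at_ex[OF cover(2)] by blast
    define P where "P = (\<lambda>l. l \<in> {1..length Hs} \<and>
      (real k, Min (heights_hit \<pi> Hs k)) \<in> top_part \<pi> (hook_at Hs l))"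
    have max: "fst (hook_at Hs l) \<le> ?i" if "P l" for l
    proof -
      obtain a b where ab: "hook_at Hs l = (a, b)" by (cases "hook_at Hs l")
      have "l \<in> {1..length Hs}" "(real k, Min (heights_hit \<pi> Hs k)) \<in> top_part \<pi> (a, b)"
        using that ab by (simp_all add: P_def)
      then have "(a, b) \<in> set Hs" "a < k" "k \<le> b"
        using hook_at_mem[of l] ab by (simp_all add: top)
      then show ?thesis using ab le_innermost by simp
    qed
    have "(real k, Min (heights_hit \<pi> Hs k)) \<in> top_part \<pi> (?i, j)"
      using cover Min by (simp add: top)
    then have "P r" using r by (simp add: P_def)
    \<comment> \<open>\<open>ARG_MAX\<close> is a choice operator; the witness \<open>r\<close> is
      needed before anything can be said about its value.\<close>
    then have "is_arg_max (\<lambda>l. fst (hook_at Hs l)) P r"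
      using max r by (auto simp: is_arg_max_def not_less)
    then have "is_arg_max (\<lambda>l. fst (hook_at Hs l)) P (arg_max (\<lambda>l. fst (hook_at Hs l)) P)"
      unfolding arg_max_def by (rule someI)
    moreover have "color \<pi> Hs k = arg_max (\<lambda>l. fst (hook_at Hs l)) P"
    proof -
      have "heights_hit \<pi> Hs k \<noteq> {}" using in_hit by blast
      then show ?thesis using cover(1) unfolding color_def NE_iff P_def by simp
    qed
    ultimately have "is_arg_max (\<lambda>l. fst (hook_at Hs l)) P (color \<pi> Hs k)" by simp
    then have c: "P (color \<pi> Hs k)" and "\<not> fst (hook_at Hs (color \<pi> Hs k)) < fst (hook_at Hs r)"
      using \<open>P r\<close> unfolding is_arg_max_def by blast+
    then have "fst (hook_at Hs (color \<pi> Hs k)) = ?i" using max[OF c] r by simp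
    moreover have "color \<pi> Hs k \<in> {1..length Hs}" using c by (simp add: P_def)
    ultimately show ?thesis by blast
  qed
qed

lemma color_eq_iff:
  assumes "k \<in> {1..n}" "l \<in> {1..n}"
  shows "color \<pi> Hs k = color \<pi> Hs l \<longleftrightarrow> innermost Hs k = innermost Hs l"
proof -
  have "fst (hook_at Hs r) \<noteq> 0" if "r \<in> {1..length Hs}" for r
    using hookD(1) hook_at_mem[OF that] by (metis not_one_le_zero prod.collapse)
  then show ?thesis
    using color_innermost[OF assms(1)] color_innermost[OF assms(2)] hook_at_inj
    by (metis atLeastAtMost_iff not_one_le_zero)
qed

lemma color_le: "k \<in> {1..n} \<Longrightarrow> color \<pi> Hs k \<le> length Hs"
  using color_innermost[of k] by auto

text \<open>Trees are nonempty, so each class must be: the hook starting at \<open>i\<close> colors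
  position \<open>i + 1\<close>, and position 1, covered by no hook, gets color 0.\<close>

lemma color_surj:
  assumes "1 \<le> n" "r \<le> length Hs"
  shows "\<exists>k\<in>{1..n}. color \<pi> Hs k = r"
proof (cases "r = 0")
  case True
  have "color \<pi> Hs 1 = 0"
    using color_innermost[of 1] assms(1) innermost_less[of 1 Hs] hookD(1) hook_at_mem
    by (metis atLeastAtMost_iff less_one not_one_le_zero order_refl prod.collapse)
  then show ?thesis using True assms(1) by force
next
  case False
  then have r: "r \<in> {1..length Hs}" using assms by auto
  obtain i j where ij: "hook_at Hs r = (i, j)" by (cases "hook_at Hs r")
  then have "(i, j) \<in> set Hs" using hook_at_mem[OF r] by simp
  then have k: "Suc i \<in> {1..n}" "innermost Hs (Suc i) = i" "i \<noteq> 0"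
    using hookD(1-3)[of i j] innermost_Suc by auto
  then have "color \<pi> Hs (Suc i) = r"
    using color_innermost[OF k(1)] hook_at_inj[OF r] ij by auto
  then show ?thesis using k by blast
qed

section \<open>Color classes as sets of positions, and Case 2\<close>

definition class_of :: "nat \<Rightarrow> nat set" where
  "class_of r = {k \<in> {1..n}. color \<pi> Hs k = r}"

lemma color_class_eq: "color_class n \<pi> Hs r = \<pi> ` class_of r"
  by (auto simp: color_class_def class_of_def)

lemma finite_class_of [simp]: "finite (class_of r)"
  by (simp add: class_of_def)

text \<open>Order by label and order by position agree on a class, so the sorted postorder of a tree
  on the class lists its positions in order.\<close>

lemma class_mono:
  assumes "a \<in> class_of r" "b \<in> class_of r"
  shows "\<pi> a < \<pi> b \<longleftrightarrow> a < b"
proof -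
  have *: "\<pi> a < \<pi> b" if "a \<in> class_of r" "b \<in> class_of r" "a < b" for a b
    using that color_eq_iff[of a b] innermost_mono[of a b] by (auto simp: class_of_def)
  show ?thesis using *[of a b] *[of b a] assms by (metis less_asym linorder_neqE_nat)
qed

lemma sw_iff: "(l, \<pi> l) \<in> SW \<pi> Hs \<longleftrightarrow> (\<exists>j. (l, j) \<in> set Hs)"
  by (force simp: SW_def sw_def)

lemma attach_point_SW:
  assumes "(l, j) \<in> set Hs"
  shows "attach_point \<pi> Hs Ts l = \<pi> j"
proof -
  have "(THE H. H \<in> set Hs \<and> sw \<pi> H = (l, \<pi> l)) = (l, j)"
    using assms hook_unique by (intro the_equality) (auto simp: sw_def)
  then show ?thesis using assms sw_iff by (auto simp: attach_point_def)
qed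

text \<open>Both \<open>l + 1\<close> and the position \<open>u\<close> in Case 2 of the map \<open>g\<close> belong to one class, and
  \<open>l \<mapsto> u\<close> inverts the passage from \<open>u\<close> to the predecessor of its successor in the class.\<close>
lemma attach_point_not_SW:
  assumes "1 \<le> l" "l < n" "\<nexists>j. (l, j) \<in> set Hs"
  obtains u where "u \<in> class_of (color \<pi> Hs (Suc l))" "u \<le> l"
    "\<And>w. w \<in> class_of (color \<pi> Hs (Suc l)) \<Longrightarrow> u < w \<Longrightarrow> Suc l \<le> w"
    "\<And>Ts. attach_point \<pi> Hs Ts l = parent (Ts ! color \<pi> Hs (Suc l)) (\<pi> u)"
proof -
  let ?r = "color \<pi> Hs (Suc l)"
  let ?i = "innermost Hs (Suc l)"
  let ?U = "{u \<in> {1..l}. color \<pi> Hs u = ?r}"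
  have l: "Suc l \<in> {1..n}" using assms by simp
  \<comment> \<open>Position \<open>?i + 1\<close> is in the class, and it is at most
    \<open>l\<close> because no hook starts at \<open>l\<close>. Hence the maximum defining
    \<open>u\<close> ranges over a nonempty set.\<close>
  have "?i < l \<and> innermost Hs (Suc ?i) = ?i"
  proof (cases rule: innermost_cases[of Hs "Suc l"])
    case 1
    then show ?thesis using innermost_less[of 1 Hs] assms(1) by simp
  next
    case (2 j)
    then have "?i \<noteq> l" using assms(3) by metis
    then show ?thesis using 2 innermost_Suc[OF 2(1)] by simp
  qed
  then have "Suc ?i \<in> ?U" using color_eq_iff[of "Suc ?i" "Suc l"] l by auto
  moreover have fin: "finite ?U" by simp
  ultimately have U: "Max ?U \<in> ?U" using Max_in by blast
  show ?thesis
  proof (rule that[of "Max ?U"])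
    show "Max ?U \<in> class_of ?r" "Max ?U \<le> l" using U assms by (auto simp: class_of_def)
    fix w assume w: "w \<in> class_of ?r" "Max ?U < w"
    show "Suc l \<le> w"
    proof (rule ccontr)
      assume "\<not> Suc l \<le> w"
      then have "w \<in> ?U" using w by (auto simp: class_of_def)
      then show False using w(2) Max_ge[OF fin] by (metis not_le)
    qed
  next
    fix Ts
    show "attach_point \<pi> Hs Ts l = parent (Ts ! ?r) (\<pi> (Max ?U))"
      using assms(3) by (simp add: attach_point_def sw_iff Let_def)
  qed
qed

text \<open>A hook starting at \<open>u' - 1\<close> would be innermost over \<open>u'\<close> but
  would not cover \<open>u\<close>, although the two share a class.\<close>

lemma next_in_class:
  assumes "u \<in> class_of r" "u' \<in> class_of r" "u < u'"
    and "\<And>w. w \<in> class_of r \<Longrightarrow> u < w \<Longrightarrow> u' \<le> w"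
  shows "\<nexists>j. (u' - 1, j) \<in> set Hs" "1 \<le> u' - 1" "u' - 1 < n"
    "attach_point \<pi> Hs Ts (u' - 1) = parent (Ts ! r) (\<pi> u)"
proof -
  let ?l = "u' - 1"
  have l: "Suc ?l = u'" "1 \<le> u" "u' \<le> n" "color \<pi> Hs u' = r"
    using assms by (auto simp: class_of_def)
  then show l': "1 \<le> ?l" "?l < n" using assms(3) by auto
  have same: "innermost Hs u' = innermost Hs u"
    using assms color_eq_iff[of u u'] by (auto simp: class_of_def)
  show nSW: "\<nexists>j. (?l, j) \<in> set Hs"
  proof
    assume "\<exists>j. (?l, j) \<in> set Hs"
    then have "innermost Hs u' = ?l" using innermost_Suc[of ?l] l by auto
    then show False using same innermost_less[of u Hs] l assms(3) by simp
  qed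
  obtain v where v: "v \<in> class_of r" "v \<le> ?l" "\<And>w. w \<in> class_of r \<Longrightarrow> v < w \<Longrightarrow> u' \<le> w"
     "\<And>Ts. attach_point \<pi> Hs Ts ?l = parent (Ts ! r) (\<pi> v)"
    using attach_point_not_SW[OF l' nSW] unfolding l(1,4) by blast
  have "v = u" using v(3)[OF assms(1)] assms(4)[OF v(1)] v(2) l assms(3) by linarith
  then show "attach_point \<pi> Hs Ts ?l = parent (Ts ! r) (\<pi> u)" using v(4) by simp
qed

definition next_in :: "nat \<Rightarrow> nat \<Rightarrow> nat" where
  "next_in r u = Min {w \<in> class_of r. u < w}"

lemma next_in:
  assumes "u \<in> class_of r" "u \<noteq> Max (class_of r)"
  shows "next_in r u \<in> class_of r" "u < next_in r u"
    and "\<And>w. w \<in> class_of r \<Longrightarrow> u < w \<Longrightarrow> next_in r u \<le> w"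
proof -
  let ?W = "{w \<in> class_of r. u < w}"
  have "Max (class_of r) \<in> class_of r" using assms(1) by (intro Max_in) auto
  moreover have "u \<le> Max (class_of r)" using assms(1) by simp
  ultimately have "Max (class_of r) \<in> ?W" using assms(2) by simp
  then have "next_in r u \<in> ?W" unfolding next_in_def by (intro Min_in) auto
  then show "next_in r u \<in> class_of r" "u < next_in r u" by auto
  show "next_in r u \<le> w" if "w \<in> class_of r" "u < w" for w
    unfolding next_in_def using that by (intro Min_le) auto
qed

lemma sorted_class_word: "sorted (map \<pi> (sorted_list_of_set (class_of r)))"
proof -
  have "sorted_wrt (\<lambda>a b. \<pi> a \<le> \<pi> b) (sorted_list_of_set (class_of r))"
    by (rule sorted_wrt_mono_rel[OF _ sorted_sorted_list_of_set])
      (metis class_mono finite_class_of le_less set_sorted_list_of_set)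
  then show ?thesis by (simp add: sorted_wrt_map)
qed

lemma class_word_eqI:
  assumes "distinct w" "sorted w" "set w = color_class n \<pi> Hs r"
  shows "w = map \<pi> (sorted_list_of_set (class_of r))"
proof (rule sorted_distinct_set_unique)
  show "distinct (map \<pi> (sorted_list_of_set (class_of r)))"
    using inj by (simp add: distinct_map inj_on_subset[OF inj subset_UNIV])
qed (use assms sorted_class_word in \<open>simp_all add: color_class_eq\<close>)

end

section \<open>The hook configuration of a tree\<close>

locale postorder_tree =
  fixes n :: nat and \<pi> p :: "nat \<Rightarrow> nat" and \<tau> :: "nat ntree"
  assumes n: "1 \<le> n"
    and perm: "\<pi> permutes {1..n}"
    and decreasing: "decreasing_ntree_on {1..n} \<tau>"
    and postorder: "postorder \<tau> = word_of n \<pi>"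
    and noncrossing: "noncrossing_parents {1..n} p"
    and parents: "parents_along \<tau> \<pi> {1..n} p"
begin

lemma inj: "inj \<pi>"
  using perm by (rule permutes_inj)

lemma p_greater: "1 \<le> i \<Longrightarrow> i < n \<Longrightarrow> i < p i"
  and p_le: "1 \<le> i \<Longrightarrow> i < n \<Longrightarrow> p i \<le> n"
  and p_noncrossing: "1 \<le> i \<Longrightarrow> i < n \<Longrightarrow> i < j \<Longrightarrow> j < p i \<Longrightarrow> p j \<le> p i"
  using noncrossing unfolding noncrossing_parents_interval[OF n] by blast+

lemma child_of_tree: "child_of \<tau> q c \<longleftrightarrow> (\<exists>i. 1 \<le> i \<and> i < n \<and> q = \<pi> (p i) \<and> c = \<pi> i)"
  using parents unfolding parents_along_interval[OF n] by blast

lemma label_less_parent: "1 \<le> i \<Longrightarrow> i < n \<Longrightarrow> \<pi> i < \<pi> (p i)"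
  using decreasing child_of_tree unfolding decreasing_ntree_on_def child_of_iff_subtrees by blast

text \<open>Following parents from \<open>j\<close>, labels increase while noncrossing keeps the
  path at or before \<open>p i\<close>, so the path ends at \<open>p i\<close>.\<close>

lemma label_below_parent:
  assumes "1 \<le> i" "i < n" "i < j" "j < p i"
  shows "\<pi> j < \<pi> (p i)"
  using assms(3,4)
proof (induction "p i - j" arbitrary: j rule: less_induct)
  case less
  have j: "1 \<le> j" "j < n" using assms less.prems p_le[of i] by auto
  have "\<pi> j < \<pi> (p j)" using label_less_parent[OF j] .
  moreover have "p j \<le> p i" using p_noncrossing assms less.prems by blast
  moreover have "\<pi> (p j) < \<pi> (p i)" if "p j < p i"
    using less.hyps[of "p j"] that p_greater[OF j] less.prems by simp
  ultimately show ?case by (cases "p j = p i") auto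
qed

definition hook_starts :: "nat set" where
  "hook_starts = {i. 1 \<le> i \<and> i < n \<and> (\<exists>d. 1 \<le> d \<and> d < n \<and> p d = p i \<and> \<pi> (Suc d) < \<pi> d)}"

definition tree_hooks :: "hook list" where
  "tree_hooks = map (\<lambda>i. (i, p i)) (sorted_list_of_set hook_starts)"

lemma finite_hook_starts [simp]: "finite hook_starts"
  by (rule finite_subset[of _ "{..n}"]) (auto simp: hook_starts_def)

lemma in_tree_hooks: "(i, j) \<in> set tree_hooks \<longleftrightarrow> i \<in> hook_starts \<and> j = p i"
  by (auto simp: tree_hooks_def)

lemma hook_starts_bounds: "i \<in> hook_starts \<Longrightarrow> 1 \<le> i \<and> i < n"
  by (simp add: hook_starts_def)

lemma hook_starts_sibling:
  "i \<in> hook_starts \<Longrightarrow> 1 \<le> l \<Longrightarrow> l < n \<Longrightarrow> p l = p i \<Longrightarrow> l \<in> hook_starts"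
  by (simp add: hook_starts_def)

lemma tree_hooks_valid: "tree_hooks \<in> valid_hook_configs n \<pi>"
  unfolding valid_hook_configs_iff in_tree_hooks
proof (intro conjI allI impI; (elim conjE)?)
  show "sorted_wrt (<) (map fst tree_hooks)"
    by (simp add: tree_hooks_def comp_def)
next
  fix i assume "1 \<le> i" "i < n" "\<pi> (Suc i) < \<pi> i"
  then show "\<exists>j. i \<in> hook_starts \<and> j = p i" by (auto simp: hook_starts_def)
next
  fix i j assume i: "i \<in> hook_starts" "j = p i"
  then have b: "1 \<le> i" "i < n" using hook_starts_bounds by blast+
  then show "1 \<le> i" "i < j" "j \<le> n" "\<pi> i < \<pi> j"
    using p_greater p_le label_less_parent i(2) by simp_all
  obtain d where d: "1 \<le> d" "d < n" "p d = p i" "\<pi> (Suc d) < \<pi> d"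
    using i by (auto simp: hook_starts_def)
  then show "\<exists>d\<ge>1. d < n \<and> \<pi> (Suc d) < \<pi> d \<and> d \<in> hook_starts \<and> j = p d"
    using i by (auto simp: hook_starts_def)
  \<comment> \<open>The position before \<open>j\<close> is the last child of \<open>j\<close>: its
    arc starts at or inside the arc from \<open>i\<close> to \<open>j\<close> and cannot leave
    it.\<close>
  let ?l = "j - 1"
  have l: "i \<le> ?l" "1 \<le> ?l" "?l < n" using p_greater[OF b] p_le[OF b] b i(2) by linarith+
  have "p ?l \<le> j"
  proof (cases "?l = i")
    case False
    then show ?thesis using p_noncrossing[OF b, of ?l] l p_greater[OF b] i(2) by simp
  qed (use i in simp)
  then have "p ?l = j" using p_greater[OF l(2,3)] by simp
  then show "j = p ?l" "?l \<in> hook_starts" using hook_starts_sibling[OF i(1) l(2,3)] i(2) by simp_all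
next
  fix i j i' j'
  assume i: "i \<in> hook_starts" "j = p i" "i' \<in> hook_starts" "j' = p i'"
    and less: "\<pi> j < \<pi> j'" "i < j'" "i' < j"
  have b: "1 \<le> i" "i < n" "1 \<le> i'" "i' < n" using hook_starts_bounds i by blast+
  \<comment> \<open>If \<open>i'\<close> came later, its arc would end inside that of
    \<open>i\<close>, where no label exceeds \<open>\<pi> j\<close>.\<close>
  have "\<not> i < i'"
  proof
    assume "i < i'"
    then have "j' \<le> j" using p_noncrossing[OF b(1,2), of i'] i less by simp
    moreover have "\<not> j' < j" using label_below_parent[OF b(1,2), of j'] i less by auto
    ultimately show False using less by simp
  qed
  then show "i' \<le> i" by simp
  then show "j \<le> j'"
    using p_noncrossing[OF b(3,4), of i] i less by (cases "i' = i") auto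
qed

lemma inj_on_positions: "inj_on \<pi> {1..n}"
  using inj inj_on_subset by blast

lemma eq_g_map_iff:
  "\<tau> = g_map n \<pi> Hs Ts \<longleftrightarrow> (\<forall>l. 1 \<le> l \<longrightarrow> l < n \<longrightarrow> attach_point \<pi> Hs Ts l = \<pi> (p l))"
proof -
  have "child_of \<tau> q (\<pi> l) \<longleftrightarrow> q = \<pi> (p l)" if "1 \<le> l" "l < n" for q l
    using that injD[OF inj] unfolding child_of_tree by blast
  then show ?thesis unfolding g_map_eq_iff[OF n inj_on_positions postorder] by auto
qed

end

section \<open>Uniqueness of the hooks and of the trees\<close>

locale tree_and_config = postorder_tree n \<pi> p \<tau> + hook_config n \<pi> Hs
  for n \<pi> p \<tau> Hs
begin

definition class_parent :: "nat \<Rightarrow> nat \<Rightarrow> nat" where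
  "class_parent r u = p (next_in r u - 1)"

lemma admissible_tree:
  assumes "admissible n \<pi> Hs Ts" "r \<le> length Hs"
  shows "distinct (postorder (Ts ! r))"
    "postorder (Ts ! r) = map \<pi> (sorted_list_of_set (class_of r))"
    "class_of r \<noteq> {}"
    "child_of (Ts ! r) q c \<Longrightarrow> c < q"
    "set (postorder (Ts ! r)) = \<pi> ` class_of r"
proof -
  have T: "decreasing_ntree_on (color_class n \<pi> Hs r) (Ts ! r)" "sorted (postorder (Ts ! r))"
    using assms unfolding admissible_def by auto
  then show "distinct (postorder (Ts ! r))" "child_of (Ts ! r) q c \<Longrightarrow> c < q"
    "set (postorder (Ts ! r)) = \<pi> ` class_of r"
    unfolding decreasing_ntree_on_def child_of_iff_subtrees color_class_eq by blast+
  show "postorder (Ts ! r) = map \<pi> (sorted_list_of_set (class_of r))"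
    using T unfolding decreasing_ntree_on_def by (intro class_word_eqI) auto
  show "class_of r \<noteq> {}" using color_surj[OF n assms(2)] by (auto simp: class_of_def)
qed

text \<open>Case 2 of the map \<open>g\<close> reveals all parents in the trees of an admissible tuple.\<close>
lemma parents_along_admissible:
  assumes adm: "admissible n \<pi> Hs Ts" and r: "r \<le> length Hs" and g: "\<tau> = g_map n \<pi> Hs Ts"
  shows "parents_along (Ts ! r) \<pi> (class_of r) (class_parent r)"
proof -
  let ?T = "Ts ! r" and ?C = "class_of r"
  note T = admissible_tree[OF adm r]
  have Max: "Max ?C \<in> ?C" using T(3) by (intro Max_in) auto
  have last: "last (postorder ?T) = \<pi> (Max ?C)"
    using T(3) by (simp add: T(2) last_map last_sorted_list_of_set)
  have parent: "parent ?T (\<pi> u) = \<pi> (class_parent r u)" if "u \<in> ?C" "u \<noteq> Max ?C" for u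
    using next_in_class[OF that(1) next_in[OF that]] g
    unfolding eq_g_map_iff class_parent_def by metis
  show ?thesis unfolding parents_along_def
  proof (intro allI iffI)
    fix q c assume ch: "child_of ?T q c"
    then have "q \<in> \<pi> ` ?C" "c \<in> \<pi> ` ?C" "c < q"
      using child_of_in_postorder[OF ch] T(4,5) by auto
    then obtain u v where uv: "u \<in> ?C" "v \<in> ?C" "c = \<pi> u" "q = \<pi> v" "\<pi> u < \<pi> v"
      by (elim imageE) simp
    then have "u < v" using class_mono by simp
    then have "u \<noteq> Max ?C" using Max_ge[OF finite_class_of uv(2)] by (metis not_le)
    then show "\<exists>i\<in>?C. i \<noteq> Max ?C \<and> q = \<pi> (class_parent r i) \<and> c = \<pi> i"
      using uv parent parent_in_tree(1)[OF T(1) ch] by metis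
  next
    fix q c assume "\<exists>i\<in>?C. i \<noteq> Max ?C \<and> q = \<pi> (class_parent r i) \<and> c = \<pi> i"
    then obtain u where u: "u \<in> ?C" "u \<noteq> Max ?C" "q = \<pi> (class_parent r u)" "c = \<pi> u" by blast
    then have "c \<noteq> last (postorder ?T)" using last injD[OF inj] by auto
    moreover have "c \<in> set (postorder ?T)" using T(5) u by auto
    ultimately show "child_of ?T q c" using parent_in_tree(3)[OF T(1)] parent u by metis
  qed
qed

lemma admissible_unique:
  assumes "admissible n \<pi> Hs Ts" "\<tau> = g_map n \<pi> Hs Ts"
    and "admissible n \<pi> Hs Ts'" "\<tau> = g_map n \<pi> Hs Ts'"
  shows "Ts = Ts'"
proof (rule nth_equalityI)
  show "length Ts = length Ts'" using assms by (simp add: admissible_def)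
  fix r assume "r < length Ts"
  then have r: "r \<le> length Hs" using assms by (simp add: admissible_def)
  show "Ts ! r = Ts' ! r"
  proof (rule tree_eqI)
    show "distinct (postorder (Ts' ! r))" "postorder (Ts ! r) = postorder (Ts' ! r)"
      using admissible_tree(1,2)[OF assms(1) r] admissible_tree(1,2)[OF assms(3) r] by simp_all
    show "child_of (Ts ! r) q c \<longleftrightarrow> child_of (Ts' ! r) q c" for q c
      using parents_along_admissible[OF assms(1) r assms(2)]
        parents_along_admissible[OF assms(3) r assms(4)] unfolding parents_along_def by simp
  qed
qed

text \<open>Case 1 turns each hook into an edge of \<tau>; condition (c) then supplies a descent
  with the same parent.\<close>

lemma hooks_in_tree:
  assumes g: "\<tau> = g_map n \<pi> Hs Ts" and ij: "(i, j) \<in> set Hs"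
  shows "j = p i" "i \<in> hook_starts"
proof -
  have *: "b = p a" if "(a, b) \<in> set Hs" for a b
    using g attach_point_SW[OF that] hookD(1-3)[OF that] injD[OF inj]
    unfolding eq_g_map_iff by (metis less_le_trans)
  then show "j = p i" using ij .
  obtain d where "1 \<le> d" "d < n" "\<pi> (Suc d) < \<pi> d" "(d, j) \<in> set Hs" using hookD(5)[OF ij] by blast
  moreover have "1 \<le> i" "i < n" using hookD(1-3)[OF ij] by auto
  ultimately show "i \<in> hook_starts" using * ij unfolding hook_starts_def by blast
qed

text \<open>Only missing hooks remain to be excluded. If a child \<open>i\<close> of a northeast
  endpoint \<open>j\<close> started no hook, Case 2 would make \<open>\<pi> j\<close> the parent of
  some \<open>\<pi> u\<close> in a tree of the tuple. Then \<open>u\<close> and \<open>j\<close>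
  share a class, so \<open>u = j\<close>, which contradicts that labels decrease from parent to
  child.\<close>

lemma hooks_forced:
  assumes adm: "admissible n \<pi> Hs Ts" and g: "\<tau> = g_map n \<pi> Hs Ts"
  shows "Hs = tree_hooks"
proof -
  have start: "\<exists>j. (i, j) \<in> set Hs" if i: "i \<in> hook_starts" for i
  proof (rule ccontr)
    assume nSW: "\<nexists>j. (i, j) \<in> set Hs"
    have b: "1 \<le> i" "i < n" using hook_starts_bounds[OF i] by auto
    obtain d where d: "1 \<le> d" "d < n" "p d = p i" "\<pi> (Suc d) < \<pi> d"
      using i by (auto simp: hook_starts_def)
    then obtain j where j: "(d, j) \<in> set Hs" using descent_hook by blast
    then have "j = p i" using hooks_in_tree[OF g] d by simp
    let ?r = "color \<pi> Hs (Suc i)"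
    obtain u where u: "u \<in> class_of ?r" "u \<le> i"
      "attach_point \<pi> Hs Ts i = parent (Ts ! ?r) (\<pi> u)"
      using attach_point_not_SW[OF b nSW] by metis
    have r: "?r \<le> length Hs" using b by (intro color_le) simp
    note T = admissible_tree[OF adm r]
    have "Suc i \<in> class_of ?r" using b by (simp add: class_of_def)
    then have "u \<noteq> Max (class_of ?r)" using u(2) Max_ge[OF finite_class_of] by fastforce
    then have "child_of (Ts ! ?r) (\<pi> (class_parent ?r u)) (\<pi> u)"
      using parents_along_admissible[OF adm r g] u(1) unfolding parents_along_def by blast
    then have ch: "child_of (Ts ! ?r) (\<pi> j) (\<pi> u)"
      using parent_in_tree(1)[OF T(1)] u(3) g b \<open>j = p i\<close> unfolding eq_g_map_iff by metis
    then have "\<pi> u < \<pi> j" by (rule T(4))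
    have "\<pi> j \<in> \<pi> ` class_of ?r" using child_of_in_postorder[OF ch] T(5) by simp
    then have "j \<in> class_of ?r" by (simp add: inj_image_mem_iff[OF inj])
    then have "innermost Hs u = innermost Hs j" "1 \<le> u"
      using u(1) color_eq_iff[of u j] by (auto simp: class_of_def)
    then have "u = j" using innermost_NE_unique[OF j] by blast
    then show False using \<open>\<pi> u < \<pi> j\<close> by simp
  qed
  have "fst ` set Hs = hook_starts"
  proof (intro equalityI subsetI)
    fix i assume "i \<in> fst ` set Hs"
    then obtain j where "(i, j) \<in> set Hs" by force
    then show "i \<in> hook_starts" by (rule hooks_in_tree[OF g])
  next
    fix i assume "i \<in> hook_starts"
    then show "i \<in> fst ` set Hs" using start by force
  qed
  then have "set (map fst Hs) = hook_starts" by simp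
  then have fst: "map fst Hs = sorted_list_of_set hook_starts"
    using sorted_Hs by (metis sorted_list_of_set.idem_if_sorted_distinct strict_sorted_iff)
  have "Hs = map (\<lambda>i. (i, p i)) (map fst Hs)"
    using hooks_in_tree(1)[OF g] by (auto simp: comp_def intro!: map_idI[symmetric])
  then show ?thesis unfolding fst tree_hooks_def .
qed

end

section \<open>Existence of admissible trees for the hooks of the given tree\<close>

context postorder_tree
begin

interpretation TC: tree_and_config n \<pi> p \<tau> tree_hooks
  by unfold_locales (rule perm tree_hooks_valid)+

text \<open>A hook that covers \<open>l + 1\<close> and starts before \<open>l\<close> encloses the
  arc of \<open>l\<close>, so it also covers \<open>p l\<close>. Conversely, a hook over
  \<open>p l\<close> that starts strictly between \<open>l\<close> and \<open>p l\<close> must end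
  at \<open>p l\<close>; then \<open>l\<close> is a sibling of its start and would start a hook
  too.\<close>

lemma innermost_parent:
  assumes "1 \<le> l" "l < n" "l \<notin> hook_starts"
  shows "innermost tree_hooks (p l) = innermost tree_hooks (Suc l)"
proof (rule innermost_eqI)
  let ?i = "innermost tree_hooks (Suc l)"
  show "?i = 0 \<or> (\<exists>j. (?i, j) \<in> set tree_hooks \<and> ?i < p l \<and> p l \<le> j)"
  proof (cases rule: innermost_cases[of tree_hooks "Suc l"])
    case (2 j)
    then have i: "?i \<in> hook_starts" "j = p ?i" by (simp_all add: in_tree_hooks)
    then have "?i \<noteq> l" using assms(3) by metis
    then have "?i < l" "l < p ?i" using 2 i by auto
    then have "p l \<le> p ?i" using p_noncrossing hook_starts_bounds[OF i(1)] by blast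
    then show ?thesis using 2(1) i(2) \<open>?i < l\<close> p_greater[OF assms(1,2)] by auto
  qed simp
next
  fix d j assume d: "(d, j) \<in> set tree_hooks" "d < p l" "p l \<le> j"
  then have d': "d \<in> hook_starts" "j = p d" by (simp_all add: in_tree_hooks)
  show "d \<le> innermost tree_hooks (Suc l)"
  proof (cases "d \<le> l")
    case True
    then show ?thesis using d p_greater[OF assms(1,2)] by (intro le_innermost[OF d(1)]) auto
  next
    case False
    then have "p d = p l" using p_noncrossing[OF assms(1,2), of d] d d'(2) by simp
    then show ?thesis using hook_starts_sibling[OF d'(1) assms(1,2)] assms(3) by simp
  qed
qed

text \<open>The map is \<open>p\<close> precomposed with the shift from \<open>u\<close> to the
  position before its successor. The shift preserves order, so noncrossing is inherited from
  \<open>p\<close>; that the values stay in the class is \<open>innermost_parent\<close>.\<close>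

lemma class_parent_noncrossing:
  "noncrossing_parents (TC.class_of r) (TC.class_parent r)"
proof -
  let ?C = "TC.class_of r" and ?s = "TC.next_in r" and ?q = "TC.class_parent r"
  have basic: "?s u \<in> ?C \<and> u < ?s u \<and> 1 \<le> ?s u - 1 \<and> ?s u - 1 < n \<and> ?q u \<in> ?C \<and> ?s u \<le> ?q u"
    if u: "u \<in> ?C" "u \<noteq> Max ?C" for u
  proof -
    let ?l = "?s u - 1"
    note nx = TC.next_in[OF u]
    note cl = TC.next_in_class[OF u(1) nx]
    have l: "1 \<le> ?l" "?l < n" "Suc ?l = ?s u" using cl(2,3) by auto
    have "?l \<notin> hook_starts" using cl(1) by (simp add: in_tree_hooks)
    then have "innermost tree_hooks (p ?l) = innermost tree_hooks (?s u)"
      using innermost_parent[OF l(1,2)] l(3) by simp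
    moreover have "p ?l \<in> {1..n}" using p_greater[OF l(1,2)] p_le[OF l(1,2)] by simp
    ultimately have "?q u \<in> ?C"
      using nx(1) TC.color_eq_iff[of "p ?l" "?s u"] by (simp add: TC.class_of_def TC.class_parent_def)
    moreover have "?s u \<le> ?q u" using p_greater[OF l(1,2)] by (simp add: TC.class_parent_def)
    ultimately show ?thesis using nx l by blast
  qed
  show ?thesis unfolding noncrossing_parents_def
  proof (intro conjI ballI impI)
    fix u assume u: "u \<in> ?C" "u \<noteq> Max ?C"
    show "?q u \<in> ?C" "u < ?q u" using basic[OF u] by auto
  next
    fix u w assume u: "u \<in> ?C" "w \<in> ?C" "u \<noteq> Max ?C" "u < w" "w < ?q u"
    note bu = basic[OF u(1,3)]
    have "?q u \<le> Max ?C" using bu by simp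
    then have w: "w \<noteq> Max ?C" using u(5) by simp
    note bw = basic[OF u(2) w]
    have "?s u \<le> w" using TC.next_in(3)[OF u(1,3) u(2,4)] .
    moreover have "?s w \<le> ?q u" using TC.next_in(3)[OF u(2) w] bu u(5) by blast
    ultimately have "?s u - 1 < ?s w - 1" "?s w - 1 < p (?s u - 1)"
      using bu bw unfolding TC.class_parent_def by linarith+
    then show "?q w \<le> ?q u"
      using p_noncrossing bu unfolding TC.class_parent_def by blast
  qed
qed

lemma ex_admissible:
  "\<exists>Ts. admissible n \<pi> tree_hooks Ts \<and> \<tau> = g_map n \<pi> tree_hooks Ts"
proof -
  let ?m = "length tree_hooks"
  have "\<exists>t. postorder t = map \<pi> (sorted_list_of_set (TC.class_of r)) \<and>
      parents_along t \<pi> (TC.class_of r) (TC.class_parent r)" if "r \<le> ?m" for r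
  proof (rule tree_of_parents[OF _ _ class_parent_noncrossing])
    show "TC.class_of r \<noteq> {}" using TC.color_surj[OF n that] by (auto simp: TC.class_of_def)
  qed simp
  then obtain T where T: "postorder (T r) = map \<pi> (sorted_list_of_set (TC.class_of r))"
    "parents_along (T r) \<pi> (TC.class_of r) (TC.class_parent r)" if "r \<le> ?m" for r
    by metis
  define Ts where "Ts = map T [0..<Suc ?m]"
  have nth: "Ts ! r = T r" if "r \<le> ?m" for r
    using that by (simp add: Ts_def del: upt_Suc)
  have adm: "admissible n \<pi> tree_hooks Ts"
    unfolding admissible_def
  proof (intro conjI ballI)
    fix r assume "r \<in> {0..?m}"
    then have r: "r \<le> ?m" by simp
    let ?C = "TC.class_of r"
    show "sorted (postorder (Ts ! r))"
      using TC.sorted_class_word by (simp add: nth[OF r] T(1)[OF r])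
    have "distinct (postorder (T r))"
      using inj by (simp add: T(1)[OF r] distinct_map inj_on_subset[OF inj subset_UNIV])
    moreover have "c < q" if ch: "child_of (T r) q c" for q c
    proof -
      obtain u where "u \<in> ?C" "u \<noteq> Max ?C" "q = \<pi> (TC.class_parent r u)" "c = \<pi> u"
        using ch T(2)[OF r] unfolding parents_along_def by blast
      moreover from this have "TC.class_parent r u \<in> ?C" "u < TC.class_parent r u"
        using class_parent_noncrossing unfolding noncrossing_parents_def by blast+
      ultimately show ?thesis using TC.class_mono by blast
    qed
    moreover have "\<pi> ` ?C \<subseteq> {1..n}"
      using permutes_image[OF perm] by (auto simp: TC.class_of_def)
    ultimately show "decreasing_ntree_on (color_class n \<pi> tree_hooks r) (Ts ! r)"
      unfolding decreasing_ntree_on_def child_of_iff_subtrees TC.color_class_eq nth[OF r]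
      using T(1)[OF r] by fastforce
  qed (simp add: Ts_def)
  moreover have "\<tau> = g_map n \<pi> tree_hooks Ts"
    unfolding eq_g_map_iff
  proof (intro allI impI)
    fix l assume l: "1 \<le> l" "l < n"
    show "attach_point \<pi> tree_hooks Ts l = \<pi> (p l)"
    proof (cases "l \<in> hook_starts")
      case True
      then show ?thesis using TC.attach_point_SW[of l "p l"] by (simp add: in_tree_hooks)
    next
      case False
      then have nSW: "\<nexists>j. (l, j) \<in> set tree_hooks" by (simp add: in_tree_hooks)
      let ?r = "color \<pi> tree_hooks (Suc l)"
      obtain u where u: "u \<in> TC.class_of ?r" "u \<le> l"
        "\<And>w. w \<in> TC.class_of ?r \<Longrightarrow> u < w \<Longrightarrow> Suc l \<le> w"
        "attach_point \<pi> tree_hooks Ts l = parent (Ts ! ?r) (\<pi> u)"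
        using TC.attach_point_not_SW[OF l nSW] by metis
      have r: "?r \<le> ?m" using l by (intro TC.color_le) simp
      have Suc: "Suc l \<in> TC.class_of ?r" using l by (simp add: TC.class_of_def)
      then have max: "u \<noteq> Max (TC.class_of ?r)"
        using u(2) Max_ge[OF TC.finite_class_of Suc] by (metis not_less_eq_eq)
      \<comment> \<open>Since \<open>u\<close> is the last class element up to \<open>l\<close>, its
        successor is \<open>l + 1\<close>, and the prescribed parent at \<open>u\<close> is exactly
        the one needed at \<open>l\<close>.\<close>
      have "TC.next_in ?r u = Suc l"
        using TC.next_in[OF u(1) max] u(2,3) Suc by (meson le_antisym le_imp_less_Suc)
      then have "TC.class_parent ?r u = p l" by (simp add: TC.class_parent_def)
      then have "child_of (Ts ! ?r) (\<pi> (p l)) (\<pi> u)"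
        using T(2)[OF r] u(1) max unfolding nth[OF r] parents_along_def by metis
      then show ?thesis
        using parent_in_tree(1)[OF TC.admissible_tree(1)[OF adm r]] u(4) by simp
    qed
  qed
  ultimately show ?thesis by blast
qed

end

theorem theorem3p1:
  fixes n :: nat and \<pi> :: "nat \<Rightarrow> nat" and \<tau> :: "nat ntree"
  assumes "n \<ge> 1"
    and "\<pi> permutes {1..n}"
    and "decreasing_ntree_on {1..n} \<tau>"
    and "postorder \<tau> = word_of n \<pi>"
  shows "\<exists>!(Hs, Ts). Hs \<in> valid_hook_configs n \<pi> \<and> admissible n \<pi> Hs Ts \<and> \<tau> = g_map n \<pi> Hs Ts"
proof -
  obtain p where "noncrossing_parents {1..n} p" "parents_along \<tau> \<pi> {1..n} p"
    using parents_of_tree[OF assms(4)[unfolded word_of_def] assms(1)] by blast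
  then interpret postorder_tree n \<pi> p \<tau>
    using assms by unfold_locales
  obtain Ts where Ts: "admissible n \<pi> tree_hooks Ts" "\<tau> = g_map n \<pi> tree_hooks Ts"
    using ex_admissible by blast
  show ?thesis
  proof (rule ex1I[of _ "(tree_hooks, Ts)"])
    show "case (tree_hooks, Ts) of (Hs, Ts) \<Rightarrow>
        Hs \<in> valid_hook_configs n \<pi> \<and> admissible n \<pi> Hs Ts \<and> \<tau> = g_map n \<pi> Hs Ts"
      using Ts tree_hooks_valid by simp
  next
    fix x assume x: "case x of (Hs, Ts) \<Rightarrow>
        Hs \<in> valid_hook_configs n \<pi> \<and> admissible n \<pi> Hs Ts \<and> \<tau> = g_map n \<pi> Hs Ts"
    obtain Hs Ts' where HT: "x = (Hs, Ts')" by (cases x)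
    with x have H: "Hs \<in> valid_hook_configs n \<pi>" "admissible n \<pi> Hs Ts'" "\<tau> = g_map n \<pi> Hs Ts'"
      by simp_all
    interpret tree_and_config n \<pi> p \<tau> Hs by unfold_locales (rule assms H)+
    have "Hs = tree_hooks" by (rule hooks_forced[OF H(2,3)])
    then show "x = (tree_hooks, Ts)" using HT admissible_unique[OF H(2,3)] Ts by simp
  qed
qed

end
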